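(* Let $X$ be a separable infinite dimensional real Banach space and let $(e_i)_{i\in\omega}$ be an asymptotic model of $X$ generated by a basic array $(x_i^n)_{n,i\in\omega}$ in $X$. Suppose that $(x_i^n)_{n,i\in\omega}$ is either a weakly null basic array or a block basic array with respect to some basic sequence in $X$. Let $(f_i)_{i\in\omega}$ be a normalized block basis of $(e_i)_{i\in\omega}$. Then $(f_i)_{i\in\omega}$ is also an asymptotic model of $X$.
   Context: $\omega=\{0,1,2,\ldots\}$ and each $n\in\omega$ is identified with $\{0,\ldots,n-1\}$. A (finite or infinite) sequence of non-zero vectors $(z_i)$ is $K$-basic if $\|\sum_{i\in n}a_iz_i\|\le K\|\sum_{i\in m}a_iz_i\|$ for all $n<m$ (with $m$ at most the length of the sequence) and all real scalars; it is basic if it is $K$-basic for some $K<\infty$. A block basis of a basic sequence $(z_i)$ is a sequence of non-zero vectors $y_k=\sum_{l=p_k}^{p_{k+1}-1}b_lz_l$ with $p_0<p_1<\cdots$. A $K$-basic array in $X$ is a family $(x_i^n)_{n,i\in\omega}\subseteq X$ such that every row $(x_i^n)_{i\in\omega}$ is a normalized $K$-basic sequence, and for all $m\in\omega$ and all integers $m\le i_0<\cdots<i_{m-1}$ the sequence $(x_{i_j}^j)_{j\in m}$ is $K$-basic. A basic array is a $K$-basic array for some $K<\infty$. (Only the entries $x_i^n$ with $i\ge n$ matter; the others may be ignored or omitted.) A weakly null basic array is a basic array each of whose rows is weakly null. A block basic array with respect to a basic sequence $(x_i)$ is a basic array whose rows are all block bases of $(x_i)$ and for which all the sequences $(x_{i_j}^j)_{j\in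 m}$, $m\le i_0<\cdots<i_{m-1}$, are also block bases of $(x_i)$. A basic array $(y_i^n)$ generates an asymptotic model if for some sequence of positive reals $\varepsilon_n\downarrow0$, for all $n$, all $(b_j)_{j\in n}\in[-1,1]^n$ and all $n\le i_0<\cdots<i_{n-1}$, $n\le\ell_0<\cdots<\ell_{n-1}$ one has $\big|\|\sum_{j\in n}b_jy_{i_j}^j\|-\|\sum_{j\in n}b_jy_{\ell_j}^j\|\big|<\varepsilon_n$. Then $\|\sum_{j\in n}b_je_j\|:=\lim_{i_0\to\infty}\cdots\lim_{i_{n-1}\to\infty}\|\sum_{j\in n}b_jy_{i_j}^j\|$ defines a norm on the space $c_{00}$ of finitely supported real sequences with unit vector basis $(e_i)_{i\in\omega}$; $(e_i)$ (a basis for the completion $E$) is called the asymptotic model of $X$ generated by $(y_i^n)$. A sequence is an asymptotic model of $X$ if it is generated in this way (up to isometric equivalence) by some basic array in $X$. *)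

theory Defs
  imports "HOL-Analysis.Analysis"
begin

definition infinite_dimensional :: "'a::real_vector itself \<Rightarrow> bool" where
  "infinite_dimensional _ \<longleftrightarrow> \<not> (\<exists>B::'a set. finite B \<and> span B = UNIV)"

definition weakly_null :: "(nat \<Rightarrow> 'a::real_normed_vector) \<Rightarrow> bool" where
  "weakly_null z \<longleftrightarrow> (\<forall>\<phi>::'a \<Rightarrow> real. bounded_linear \<phi> \<longrightarrow> (\<lambda>i. \<phi> (z i)) \<longlonglongrightarrow> 0)"

text \<open>A sequence of length \<open>N \<le> \<infinity>\<close> is a total function of which only the values at indices
  \<open>i < N\<close> are used.\<close>

definition K_basic_seq :: "real \<Rightarrow> enat \<Rightarrow> (nat \<Rightarrow> 'a::real_normed_vector) \<Rightarrow> bool" where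
  "K_basic_seq K N z \<longleftrightarrow>
     (\<forall>i. enat i < N \<longrightarrow> z i \<noteq> 0) \<and>
     (\<forall>n m (a :: nat \<Rightarrow> real). n < m \<and> enat m \<le> N \<longrightarrow>
        norm (\<Sum>i<n. a i *\<^sub>R z i) \<le> K * norm (\<Sum>i<m. a i *\<^sub>R z i))"

definition basic_seq :: "enat \<Rightarrow> (nat \<Rightarrow> 'a::real_normed_vector) \<Rightarrow> bool" where
  "basic_seq N z \<longleftrightarrow> (\<exists>K. K_basic_seq K N z)"

text \<open>The first \<open>N\<close> terms of \<open>y\<close> form a block basis of the infinite sequence \<open>z\<close>. For finite \<open>N\<close>
  only \<open>p 0 < \<dots> < p N\<close> matter, and any such choice extends to a strictly increasing sequence.\<close>

definition block_basis :: "enat \<Rightarrow> (nat \<Rightarrow> 'a::real_normed_vector) \<Rightarrow> (nat \<Rightarrow> 'a) \<Rightarrow> bool" where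
  "block_basis N y z \<longleftrightarrow>
     (\<exists>(p :: nat \<Rightarrow> nat) (b :: nat \<Rightarrow> real). strict_mono p \<and>
        (\<forall>k. enat k < N \<longrightarrow> y k \<noteq> 0 \<and> y k = (\<Sum>l = p k..<p (Suc k). b l *\<^sub>R z l)))"

text \<open>\<open>m \<le> i\<^sub>0 < \<dots> < i\<^bsub>m-1\<^esub>\<close>\<close>

definition admissible :: "nat \<Rightarrow> (nat \<Rightarrow> nat) \<Rightarrow> bool" where
  "admissible m i \<longleftrightarrow> (\<forall>j<m. m \<le> i j) \<and> strict_mono_on {..<m} i"

text \<open>An array is a function \<open>x\<close>, with \<open>x n i\<close> the \<open>i\<close>-th entry of row \<open>n\<close>. Rows are indexed by
  all \<open>i\<close>; an array of entries with \<open>i \<ge> n\<close> only corresponds to the full array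
  \<open>\<lambda>n i. x n (n + i)\<close>.\<close>

definition K_basic_array :: "real \<Rightarrow> (nat \<Rightarrow> nat \<Rightarrow> 'a::real_normed_vector) \<Rightarrow> bool" where
  "K_basic_array K x \<longleftrightarrow>
     (\<forall>n. (\<forall>i. norm (x n i) = 1) \<and> K_basic_seq K \<infinity> (x n)) \<and>
     (\<forall>m i. admissible m i \<longrightarrow> K_basic_seq K (enat m) (\<lambda>j. x j (i j)))"

definition basic_array :: "(nat \<Rightarrow> nat \<Rightarrow> 'a::real_normed_vector) \<Rightarrow> bool" where
  "basic_array x \<longleftrightarrow> (\<exists>K. K_basic_array K x)"

definition weakly_null_basic_array :: "(nat \<Rightarrow> nat \<Rightarrow> 'a::real_normed_vector) \<Rightarrow> bool" where
  "weakly_null_basic_array x \<longleftrightarrow> basic_array x \<and> (\<forall>n. weakly_null (x n))"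

definition block_basic_array ::
  "(nat \<Rightarrow> nat \<Rightarrow> 'a::real_normed_vector) \<Rightarrow> (nat \<Rightarrow> 'a) \<Rightarrow> bool" where
  "block_basic_array x z \<longleftrightarrow> basic_array x \<and>
     (\<forall>n. block_basis \<infinity> (x n) z) \<and>
     (\<forall>m i. admissible m i \<longrightarrow> block_basis (enat m) (\<lambda>j. x j (i j)) z)"

definition generates_asymptotic_model ::
  "(nat \<Rightarrow> nat \<Rightarrow> 'a::real_normed_vector) \<Rightarrow> bool" where
  "generates_asymptotic_model y \<longleftrightarrow> basic_array y \<and>
     (\<exists>\<epsilon> :: nat \<Rightarrow> real. (\<forall>n. 0 < \<epsilon> n) \<and> decseq \<epsilon> \<and> \<epsilon> \<longlonglongrightarrow> 0 \<and>
        (\<forall>n (b :: nat \<Rightarrow> real) i l.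
           (\<forall>j<n. b j \<in> {-1..1}) \<and> admissible n i \<and> admissible n l \<longrightarrow>
           \<bar>norm (\<Sum>j<n. b j *\<^sub>R y j (i j)) - norm (\<Sum>j<n. b j *\<^sub>R y j (l j))\<bar> < \<epsilon> n))"

text \<open>The iterated limit of \<open>F [i\<^sub>0, \<dots>, i\<^bsub>n-1\<^esub>]\<close> as \<open>i\<^sub>0 \<rightarrow> \<infinity>\<close> (outermost), \dots,
  \<open>i\<^bsub>n-1\<^esub> \<rightarrow> \<infinity>\<close> (innermost) is taken as convergence along the iterated filter: for each
  \<open>\<epsilon> > 0\<close>, for all large \<open>i\<^sub>0\<close>, for all large \<open>i\<^sub>1\<close>, \dots, \<open>\<bar>F [i\<^sub>0, \<dots>, i\<^bsub>n-1\<^esub>] - L\<bar> < \<epsilon>\<close>.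
  The condition defining an array that generates an asymptotic model does not force the inner
  limits with \<open>i\<^sub>0\<close> held fixed to exist (they may oscillate by an amount tending to 0 as
  \<open>i\<^sub>0 \<rightarrow> \<infinity>\<close>). When all of them exist, the two notions agree
  (\<open>nested_limit_imp_iterated_limit\<close>, \<open>iterated_limit_unique\<close>).\<close>

primrec iter_eventually :: "nat \<Rightarrow> (nat list \<Rightarrow> bool) \<Rightarrow> bool" where
  "iter_eventually 0 P \<longleftrightarrow> P []"
| "iter_eventually (Suc n) P \<longleftrightarrow>
     (\<forall>\<^sub>F i in sequentially. iter_eventually n (\<lambda>is. P (i # is)))"

definition iterated_limit :: "nat \<Rightarrow> (nat list \<Rightarrow> real) \<Rightarrow> real \<Rightarrow> bool" where
  "iterated_limit n F L \<longleftrightarrow> (\<forall>\<epsilon>>0. iter_eventually n (\<lambda>is. \<bar>F is - L\<bar> < \<epsilon>))"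

primrec nested_limit :: "nat \<Rightarrow> (nat list \<Rightarrow> real) \<Rightarrow> real \<Rightarrow> bool" where
  "nested_limit 0 F L \<longleftrightarrow> F [] = L"
| "nested_limit (Suc n) F L \<longleftrightarrow>
     (\<exists>G. (\<forall>\<^sub>F i in sequentially. nested_limit n (\<lambda>is. F (i # is)) (G i)) \<and> G \<longlonglongrightarrow> L)"

lemma iter_eventually_mono:
  assumes "iter_eventually n P" "\<And>is. P is \<Longrightarrow> Q is"
  shows "iter_eventually n Q"
  using assms
proof (induction n arbitrary: P Q)
  case (Suc n)
  have "iter_eventually n (\<lambda>is. Q (i # is))" if "iter_eventually n (\<lambda>is. P (i # is))" for i
    by (rule Suc.IH[OF that]) (rule Suc.prems(2))
  then show ?case
    using Suc.prems(1) by (simp only: iter_eventually.simps) (rule eventually_mono)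
qed simp

lemma iter_eventually_conj:
  assumes "iter_eventually n P" "iter_eventually n Q"
  shows "iter_eventually n (\<lambda>is. P is \<and> Q is)"
  using assms
proof (induction n arbitrary: P Q)
  case (Suc n)
  from Suc.prems have
    "\<forall>\<^sub>F i in sequentially. iter_eventually n (\<lambda>is. P (i # is)) \<and> iter_eventually n (\<lambda>is. Q (i # is))"
    by (simp add: eventually_conj)
  then show ?case
    by (simp only: iter_eventually.simps) (erule eventually_mono, erule conjE, rule Suc.IH)
qed simp

lemma iter_eventually_const: "iter_eventually n (\<lambda>_. c) \<longleftrightarrow> c"
  by (induction n) simp_all

lemma iterated_limit_unique:
  assumes "iterated_limit n F L" "iterated_limit n F M"
  shows "L = M"
proof (rule ccontr)
  assume "L \<noteq> M"
  then have "\<bar>L - M\<bar> / 2 > 0" by simp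
  note close = assms[unfolded iterated_limit_def, rule_format, OF this]
  from iter_eventually_conj[OF close]
  have "iter_eventually n (\<lambda>_. False)"
    by (rule iter_eventually_mono) (auto simp: abs_if split: if_splits)
  then show False by (simp only: iter_eventually_const)
qed

lemma nested_limit_imp_iterated_limit:
  assumes "nested_limit n F L"
  shows "iterated_limit n F L"
  using assms
proof (induction n arbitrary: F L)
  case 0
  then show ?case by (simp add: iterated_limit_def)
next
  case (Suc n)
  then obtain G where G: "\<forall>\<^sub>F i in sequentially. nested_limit n (\<lambda>is. F (i # is)) (G i)"
    and lim: "G \<longlonglongrightarrow> L" by auto
  show ?case unfolding iterated_limit_def iter_eventually.simps
  proof (intro allI impI)
    fix \<epsilon> :: real assume "\<epsilon> > 0"
    then have e2: "\<epsilon> / 2 > 0" by simp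
    have "\<forall>\<^sub>F i in sequentially. \<bar>G i - L\<bar> < \<epsilon> / 2"
      using tendstoD[OF lim e2] by (simp add: dist_real_def)
    with G show "\<forall>\<^sub>F i in sequentially. iter_eventually n (\<lambda>is. \<bar>F (i # is) - L\<bar> < \<epsilon>)"
    proof eventually_elim
      case (elim i)
      have "iter_eventually n (\<lambda>is. \<bar>F (i # is) - G i\<bar> < \<epsilon> / 2)"
        using Suc.IH[OF elim(1), unfolded iterated_limit_def, rule_format, OF e2] .
      then show ?case
        by (rule iter_eventually_mono) (use elim(2) in linarith)
    qed
  qed
qed

text \<open>The norm on finitely supported sequences is represented by a sequence \<open>e\<close> in a Banach space
  with \<open>norm (\<Sum>j<n. b j *\<^sub>R e j)\<close> equal to the limit; this determines \<open>e\<close> up to isometric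
  equivalence, and the completion is the closed span of \<open>e\<close>.\<close>

definition asymptotic_model_generated_by ::
  "(nat \<Rightarrow> 'b::banach) \<Rightarrow> (nat \<Rightarrow> nat \<Rightarrow> 'a::banach) \<Rightarrow> bool" where
  "asymptotic_model_generated_by e y \<longleftrightarrow> generates_asymptotic_model y \<and>
     (\<forall>n (b :: nat \<Rightarrow> real).
        iterated_limit n (\<lambda>is. norm (\<Sum>j<n. b j *\<^sub>R y j (is ! j))) (norm (\<Sum>j<n. b j *\<^sub>R e j)))"

definition asymptotic_model_of :: "'a::banach itself \<Rightarrow> (nat \<Rightarrow> 'b::banach) \<Rightarrow> bool" where
  "asymptotic_model_of _ e \<longleftrightarrow> (\<exists>y :: nat \<Rightarrow> nat \<Rightarrow> 'a. asymptotic_model_generated_by e y)"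

end

theory Submission
  imports Defs
begin

text \<open>Write \<open>f k = (\<Sum>l = p k..<p (Suc k). b l *\<^sub>R e l)\<close> with \<open>p 0 = 0\<close>. The new array has as entries the
  normalized vectors \<open>\<Sum>l = p k..<p (Suc k). b l *\<^sub>R x l (N + l)\<close> for \<open>N\<close> in a fast growing sequence
  \<open>M\<close>. A diagonal of the new array is, up to scaling, a block basis of a diagonal of \<open>x\<close>, so it inherits
  the basis constant, and its norms are uniformly close to those of \<open>f\<close>. Only the basis constants
  of the rows need the extra hypothesis on \<open>x\<close>. If the rows of \<open>x\<close> are weakly null, then so are the new
  rows, and Mazur's construction (norming functionals for a finite net in the sphere of the
  finite-dimensional span of the earlier vectors) gives the constant 2. If the rows of \<open>x\<close> are block
  bases of a basic sequence \<open>z\<close>, a fast growing \<open>M\<close> makes the new rows block bases of \<open>z\<close>.\<close>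

subsection \<open>Norming functionals\<close>

text \<open>Homogeneity is demanded only as an inequality for positive scalars. The reverse follows
  by scaling with \<open>inverse c\<close>, so for infima only one direction has to be
  verified.\<close>

definition sublinear :: "('a::real_vector \<Rightarrow> real) \<Rightarrow> bool" where
  "sublinear q \<longleftrightarrow> (\<forall>x y. q (x + y) \<le> q x + q y) \<and> (\<forall>c>0. \<forall>x. q (c *\<^sub>R x) \<le> c * q x)"

lemma sublinear_add: "sublinear q \<Longrightarrow> q (x + y) \<le> q x + q y"
  by (simp add: sublinear_def)

lemma sublinear_scale:
  assumes "sublinear q" "0 < c"
  shows "q (c *\<^sub>R x) = c * q x"
proof (rule antisym)
  have "q (inverse c *\<^sub>R (c *\<^sub>R x)) \<le> inverse c * q (c *\<^sub>R x)"
    using assms unfolding sublinear_def by (metis inverse_positive_iff_positive)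
  then show "c * q x \<le> q (c *\<^sub>R x)"
    using assms(2) by (simp add: field_simps)
qed (use assms in \<open>simp add: sublinear_def\<close>)

lemma sublinear_zero: "sublinear q \<Longrightarrow> q 0 = 0"
  using sublinear_scale[of q 2 0] by simp

lemma sublinear_ge_minus: "sublinear q \<Longrightarrow> - q (- x) \<le> q x"
  using sublinear_add[of q x "- x"] sublinear_zero[of q] by simp

text \<open>For sublinear \<open>q\<close> this is the largest sublinear functional below
  \<open>q\<close> whose value at \<open>- v\<close> is at most \<open>- q v\<close>. Hence a linear
  functional below it must take the value \<open>q v\<close> at \<open>v\<close>.\<close>

definition sublinear_tilt :: "('a::real_vector \<Rightarrow> real) \<Rightarrow> 'a \<Rightarrow> 'a \<Rightarrow> real" where
  "sublinear_tilt q v x = (INF t\<in>{0..}. q (x + t *\<^sub>R v) - t * q v)"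

lemma sublinear_tilt_le:
  assumes "sublinear q" "0 \<le> t"
  shows "sublinear_tilt q v x \<le> q (x + t *\<^sub>R v) - t * q v"
  unfolding sublinear_tilt_def
proof (rule cINF_lower)
  show "bdd_below ((\<lambda>t. q (x + t *\<^sub>R v) - t * q v) ` {0..})"
  proof (rule bdd_belowI2)
    fix s :: real assume "s \<in> {0..}"
    then have "s * q v = q (s *\<^sub>R v)"
      using sublinear_scale[OF assms(1), of s v] sublinear_zero[OF assms(1)] by (cases "s = 0") auto
    also have "\<dots> \<le> q (x + s *\<^sub>R v) + q (- x)"
      using sublinear_add[OF assms(1), of "x + s *\<^sub>R v" "- x"] by simp
    finally show "- q (- x) \<le> q (x + s *\<^sub>R v) - s * q v" by simp
  qed
qed (use assms(2) in simp)

lemma sublinear_tilt_greatest: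
  assumes "\<And>t. 0 \<le> t \<Longrightarrow> m \<le> q (x + t *\<^sub>R v) - t * q v"
  shows "m \<le> sublinear_tilt q v x"
  unfolding sublinear_tilt_def by (rule cINF_greatest) (use assms in auto)

text \<open>Parameters \<open>s\<close> for \<open>x\<close> and \<open>t\<close> for
  \<open>y\<close> combine to \<open>s + t\<close> for \<open>x + y\<close>, and the two infima are
  then taken one after the other.\<close>

lemma sublinear_sublinear_tilt:
  assumes q: "sublinear q"
  shows "sublinear (sublinear_tilt q v)"
  unfolding sublinear_def
proof (intro conjI allI impI)
  fix x y
  have "sublinear_tilt q v (x + y) - (q (y + t *\<^sub>R v) - t * q v) \<le> q (x + s *\<^sub>R v) - s * q v"
    if "0 \<le> s" "0 \<le> t" for s t
  proof -
    have "sublinear_tilt q v (x + y) \<le> q ((x + s *\<^sub>R v) + (y + t *\<^sub>R v)) - (s + t) * q v"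
      using sublinear_tilt_le[OF q, of "s + t" v "x + y"] that by (simp add: algebra_simps)
    then show ?thesis
      using sublinear_add[OF q, of "x + s *\<^sub>R v" "y + t *\<^sub>R v"] by (simp add: algebra_simps)
  qed
  then have "sublinear_tilt q v (x + y) - (q (y + t *\<^sub>R v) - t * q v) \<le> sublinear_tilt q v x"
    if "0 \<le> t" for t
    by (intro sublinear_tilt_greatest) (use that in auto)
  then have "sublinear_tilt q v (x + y) - sublinear_tilt q v x \<le> sublinear_tilt q v y"
    by (intro sublinear_tilt_greatest) (simp add: algebra_simps)
  then show "sublinear_tilt q v (x + y) \<le> sublinear_tilt q v x + sublinear_tilt q v y"
    by simp
next
  fix c :: real and x assume c: "0 < c"
  have "sublinear_tilt q v (c *\<^sub>R x) / c \<le> q (x + t *\<^sub>R v) - t * q v" if "0 \<le> t" for t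
  proof -
    have "sublinear_tilt q v (c *\<^sub>R x) \<le> q (c *\<^sub>R (x + t *\<^sub>R v)) - (c * t) * q v"
      using sublinear_tilt_le[OF q, of "c * t" v "c *\<^sub>R x"] that c by (simp add: algebra_simps)
    then show ?thesis
      using sublinear_scale[OF q c, of "x + t *\<^sub>R v"] c by (simp add: field_simps)
  qed
  then have "sublinear_tilt q v (c *\<^sub>R x) / c \<le> sublinear_tilt q v x"
    by (rule sublinear_tilt_greatest)
  then show "sublinear_tilt q v (c *\<^sub>R x) \<le> c * sublinear_tilt q v x"
    using c by (simp add: field_simps)
qed

text \<open>This supplies the lower bounds of chains for Zorn's lemma. Infima of sublinear
  functionals need not be subadditive, but in a chain two members can be replaced by the smaller
  one. The common upper bound \<open>p\<close> keeps the infimum finite.\<close>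

lemma sublinear_INF_chain:
  assumes "C \<noteq> {}" and sub: "\<And>q. q \<in> C \<Longrightarrow> sublinear q" and le: "\<And>q. q \<in> C \<Longrightarrow> q \<le> p"
    and chain: "\<And>q r. q \<in> C \<Longrightarrow> r \<in> C \<Longrightarrow> q \<le> r \<or> r \<le> q"
  defines "L \<equiv> \<lambda>x. INF q\<in>C. q x"
  shows "sublinear L" "\<And>q. q \<in> C \<Longrightarrow> L \<le> q"
proof -
  have lower: "L x \<le> q x" if "q \<in> C" for q x
    unfolding L_def
  proof (rule cINF_lower[OF _ that], rule bdd_belowI2)
    fix r assume r: "r \<in> C"
    show "- p (- x) \<le> r x"
      using sublinear_ge_minus[OF sub[OF r], of x] le_funD[OF le[OF r], of "- x"] by linarith
  qed
  have greatest: "m \<le> L x" if "\<And>q. q \<in> C \<Longrightarrow> m \<le> q x" for m x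
    unfolding L_def by (rule cINF_greatest) (use assms(1) that in auto)
  show "L \<le> q" if "q \<in> C" for q
    using lower[OF that] by (simp add: le_fun_def)
  show "sublinear L"
    unfolding sublinear_def
  proof (intro conjI allI impI)
    fix x y
    have "L (x + y) \<le> q x + r y" if qr: "q \<in> C" "r \<in> C" for q r
    proof -
      obtain s where s: "s \<in> C" "s \<le> q" "s \<le> r"
        using chain[OF qr] qr by auto
      have "L (x + y) \<le> s x + s y"
        using lower[OF s(1), of "x + y"] sublinear_add[OF sub[OF s(1)], of x y] by linarith
      then show ?thesis
        using le_funD[OF s(2), of x] le_funD[OF s(3), of y] by linarith
    qed
    then have "L (x + y) - r y \<le> L x" if "r \<in> C" for r
      by (intro greatest) (use that in \<open>simp add: algebra_simps\<close>)
    then have "L (x + y) - L x \<le> L y"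
      by (intro greatest) (simp add: algebra_simps)
    then show "L (x + y) \<le> L x + L y" by simp
  next
    fix c :: real and x assume c: "0 < c"
    have "L (c *\<^sub>R x) / c \<le> L x"
    proof (rule greatest)
      fix q assume "q \<in> C"
      then show "L (c *\<^sub>R x) / c \<le> q x"
        using lower[of q "c *\<^sub>R x"] sublinear_scale[OF sub c, of q x] c by (simp add: field_simps)
    qed
    then show "L (c *\<^sub>R x) \<le> c * L x"
      using c by (simp add: field_simps)
  qed
qed

text \<open>A minimal sublinear functional agrees with all its tilts, and this forces linearity.\<close>

lemma linear_below_sublinear:
  fixes p :: "'a::real_vector \<Rightarrow> real"
  assumes "sublinear p"
  shows "\<exists>\<phi>. linear \<phi> \<and> \<phi> \<le> p"
proof -
  let ?A = "{q. sublinear q \<and> q \<le> p}"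
  \<comment> \<open>The order is reversed, so Zorn's lemma yields a minimal sublinear functional
    below \<open>p\<close>.\<close>
  have "\<exists>m\<in>?A. \<forall>a\<in>?A. a \<le> m \<longrightarrow> a = m"
  proof (rule predicate_Zorn)
    show "partial_order_on ?A (relation_of (\<lambda>m a. a \<le> m) ?A)"
      by (rule partial_order_on_relation_ofI) auto
    fix C assume C: "C \<in> Chains (relation_of (\<lambda>m a. a \<le> m) ?A)"
    then have CA: "C \<subseteq> ?A" and ch: "\<And>q r. q \<in> C \<Longrightarrow> r \<in> C \<Longrightarrow> q \<le> r \<or> r \<le> q"
      unfolding Chains_def relation_of_def by auto
    show "\<exists>u\<in>?A. \<forall>a\<in>C. u \<le> a"
    proof (cases "C = {}")
      case True
      then show ?thesis using assms by auto
    next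
      case False
      then obtain q where q: "q \<in> C" by auto
      have sub: "sublinear r" "r \<le> p" if "r \<in> C" for r
        using CA that by auto
      note L = sublinear_INF_chain[OF False sub ch, simplified]
      have "(\<lambda>x. INF q\<in>C. q x) \<le> p"
        using L(2)[OF q] sub(2)[OF q] by (rule order_trans)
      with L show ?thesis by blast
    qed
  qed
  then obtain q where q: "sublinear q" "q \<le> p"
    and min: "\<And>r. sublinear r \<Longrightarrow> r \<le> p \<Longrightarrow> r \<le> q \<Longrightarrow> r = q"
    by auto
  \<comment> \<open>Oddness is what minimality gives. Subadditivity at \<open>- x\<close> and
    \<open>- y\<close> then reverses the inequality at \<open>x\<close> and \<open>y\<close>, and
    homogeneity extends to negative scalars.\<close>
  have neg: "q (- v) = - q v" for v
  proof (rule antisym)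
    have "sublinear_tilt q v \<le> q"
      using sublinear_tilt_le[OF q(1), of 0 v] by (simp add: le_fun_def)
    with q(2) have "sublinear_tilt q v = q"
      by (intro min sublinear_sublinear_tilt q(1)) (auto intro: order_trans)
    then show "q (- v) \<le> - q v"
      using sublinear_tilt_le[OF q(1), of 1 v "- v"] sublinear_zero[OF q(1)] by simp
  qed (use sublinear_ge_minus[OF q(1), of v] in simp)
  have "linear q"
  proof (rule linearI)
    fix x y
    show "q (x + y) = q x + q y"
      using sublinear_add[OF q(1), of x y] sublinear_add[OF q(1), of "- x" "- y"] neg[of "x + y"]
        neg[of x] neg[of y] by (simp add: algebra_simps)
  next
    fix c :: real and x
    consider "c > 0" | "c = 0" | "c < 0" by linarith
    then show "q (c *\<^sub>R x) = c *\<^sub>R q x"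
    proof cases
      case 3
      then show ?thesis
        using sublinear_scale[OF q(1), of "- c" x] neg[of "c *\<^sub>R x"] by simp
    qed (use sublinear_scale[OF q(1)] sublinear_zero[OF q(1)] in auto)
  qed
  with q(2) show ?thesis by blast
qed

text \<open>A linear functional below the tilt of the norm in direction \<open>v\<close> works:
  parameter 0 bounds it by the norm, and parameter 1 at \<open>- v\<close> gives
  \<open>norm v \<le> \<phi> v\<close>.\<close>

lemma norming_functional:
  fixes v :: "'a::real_normed_vector"
  obtains \<phi> :: "'a \<Rightarrow> real" where "bounded_linear \<phi>" "\<phi> v = norm v" "\<And>x. \<bar>\<phi> x\<bar> \<le> norm x"
proof -
  have norm: "sublinear (norm :: 'a \<Rightarrow> real)"
    by (auto simp: sublinear_def norm_triangle_ineq)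
  obtain \<phi> where lin: "linear \<phi>" and le: "\<phi> \<le> sublinear_tilt norm v"
    using linear_below_sublinear[OF sublinear_sublinear_tilt[OF norm]] by blast
  have below: "\<phi> x \<le> norm (x + t *\<^sub>R v) - t * norm v" if "0 \<le> t" for x t
    using le_funD[OF le] sublinear_tilt_le[OF norm that] by (rule order_trans)
  have abs: "\<bar>\<phi> x\<bar> \<le> norm x" for x
    using below[of 0 x] below[of 0 "- x"] linear_neg[OF lin, of x] by (simp add: abs_le_iff)
  have "bounded_linear \<phi>"
    using lin abs by (auto simp: bounded_linear_def bounded_linear_axioms_def intro!: exI[of _ 1])
  moreover have "\<phi> v = norm v"
    using below[of 1 "- v"] abs[of v] linear_neg[OF lin, of v] by (simp add: abs_le_iff)
  ultimately show ?thesis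
    using that abs by blast
qed

subsection \<open>Weakly null sequences and finite-dimensional subspaces\<close>

text \<open>A convergent sequence is bounded, so it lies in one of the compact parts, which then
  contains the limit.\<close>

lemma closed_if_bounded_parts_compact:
  fixes S :: "'a::real_normed_vector set"
  assumes "\<And>\<rho>. compact (cball 0 \<rho> \<inter> S)"
  shows "closed S"
  unfolding closed_sequential_limits
proof (intro allI impI, elim conjE)
  fix s l assume s: "\<forall>n. s n \<in> S" and lim: "s \<longlonglongrightarrow> l"
  then obtain \<rho> where "\<And>n. norm (s n) \<le> \<rho>"
    using convergent_imp_Bseq[of s] unfolding convergent_def Bseq_def by blast
  with s have "\<forall>n. s n \<in> cball 0 \<rho> \<inter> S" by simp
  then have "l \<in> cball 0 \<rho> \<inter> S"
    using compact_imp_closed[OF assms[of \<rho>]] lim closed_sequential_limits by blast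
  then show "l \<in> S" by simp
qed

text \<open>Induction on \<open>B\<close>. A new vector \<open>b\<close> has positive distance from
  the closed subspace \<open>span B\<close>, which bounds the coefficient of \<open>b\<close> on a
  ball. The ball is then a closed part of the image of a compact product.\<close>

lemma compact_cball_Int_span:
  fixes B :: "'a::real_normed_vector set"
  assumes "finite B"
  shows "compact (cball 0 \<rho> \<inter> span B)"
  using assms
proof (induction B arbitrary: \<rho> rule: finite_induct)
  case empty
  have "cball 0 \<rho> \<inter> {0 :: 'a} = {} \<or> cball 0 \<rho> \<inter> {0 :: 'a} = {0}" by auto
  then show ?case by (auto simp: span_empty)
next
  case (insert b B)
  show ?case
  proof (cases "b \<in> span B")
    case True
    then show ?thesis
      using insert.IH by (simp add: span_redundant)
  next
    case False
    have "closed (span B)"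
      by (rule closed_if_bounded_parts_compact) (rule insert.IH)
    then have "open (- span B)" by (rule open_Compl)
    with False obtain d where d: "d > 0" "ball b d \<subseteq> - span B"
      by (auto elim: openE)
    have far: "d \<le> dist b v" if "v \<in> span B" for v
      using d(2) that by (force simp: subset_iff)
    have coeff: "\<bar>t\<bar> * d \<le> norm (t *\<^sub>R b + v)" if v: "v \<in> span B" for t v
    proof (cases "t = 0")
      case False
      have "(- inverse t) *\<^sub>R v \<in> span B"
        using v by (rule span_scale)
      then have "d \<le> norm ((- inverse t) *\<^sub>R v - b)"
        using far by (metis dist_norm norm_minus_commute)
      then have "\<bar>t\<bar> * d \<le> \<bar>- t\<bar> * norm ((- inverse t) *\<^sub>R v - b)"
        by (simp add: mult_left_mono)
      also have "\<dots> = norm ((- t) *\<^sub>R ((- inverse t) *\<^sub>R v - b))"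
        by simp
      also have "(- t) *\<^sub>R ((- inverse t) *\<^sub>R v - b) = t *\<^sub>R b + v"
        using False by (simp add: algebra_simps)
      finally show ?thesis .
    qed simp
    let ?g = "\<lambda>(t, v). t *\<^sub>R b + v"
    let ?D = "{- (\<rho> / d)..\<rho> / d} \<times> (cball 0 (\<rho> + \<rho> / d * norm b) \<inter> span B)"
    have "cball 0 \<rho> \<inter> span (insert b B) = cball 0 \<rho> \<inter> ?g ` ?D"
    proof (intro equalityI subsetI IntI)
      fix w assume w: "w \<in> cball 0 \<rho> \<inter> span (insert b B)"
      then obtain t where v: "w - t *\<^sub>R b \<in> span B"
        by (auto simp: span_breakdown_eq)
      have wr: "norm w \<le> \<rho>" using w by simp
      have t: "\<bar>t\<bar> \<le> \<rho> / d"
        using coeff[OF v, of t] wr d(1) by (simp add: field_simps)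
      have "norm (w - t *\<^sub>R b) \<le> \<rho> + \<rho> / d * norm b"
        using norm_triangle_ineq4[of w "t *\<^sub>R b"] wr mult_right_mono[OF t, of "norm b"] by simp
      with v t have "(t, w - t *\<^sub>R b) \<in> ?D" by (auto simp: abs_le_iff)
      then show "w \<in> ?g ` ?D"
        by (rule rev_image_eqI) simp
    next
      fix w assume "w \<in> cball 0 \<rho> \<inter> ?g ` ?D"
      then obtain t u where "w = t *\<^sub>R b + u" "u \<in> span B" by auto
      then show "w \<in> span (insert b B)"
        by (auto simp: span_breakdown_eq intro: exI[of _ t])
    qed auto
    moreover have "compact (?g ` ?D)"
      by (intro compact_continuous_image compact_Times compact_Icc insert.IH)
        (simp add: case_prod_unfold continuous_intros)
    ultimately show ?thesis
      by (simp add: closed_Int_compact)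
  qed
qed

text \<open>A functional that norms a given vector nearly vanishes on \<open>w i\<close> for large
  \<open>i\<close>, so adding a multiple of \<open>w i\<close> hardly shortens that vector. By
  compactness finitely many functionals suffice for the whole unit sphere of
  \<open>span B\<close>.\<close>

lemma weakly_null_eventually_almost_orthogonal:
  fixes w :: "nat \<Rightarrow> 'a::real_normed_vector"
  assumes "finite B" "weakly_null w" and low: "\<forall>\<^sub>F i in sequentially. 1/2 \<le> norm (w i)" and "1 < \<theta>"
  shows "\<forall>\<^sub>F i in sequentially. \<forall>v\<in>span B. \<forall>t. norm v \<le> \<theta> * norm (v + t *\<^sub>R w i)"
proof -
  \<comment> \<open>The estimate on the unit sphere loses \<open>4 * \<delta>\<close> through
    \<open>t * \<phi> x (w i)\<close>, and \<open>\<delta>\<close> each through \<open>x - v\<close>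
    and \<open>norm x\<close>.\<close>
  define \<delta> where "\<delta> = (1 - 1 / \<theta>) / 6"
  have \<delta>: "\<delta> > 0" "1 - 6 * \<delta> = 1 / \<theta>"
    using assms(4) by (simp_all add: \<delta>_def field_simps)
  obtain k where k: "finite k" "cball 0 1 \<inter> span B \<subseteq> (\<Union>x\<in>k. ball x \<delta>)"
    using compact_cball_Int_span[OF assms(1), of 1] \<delta>(1) unfolding compact_eq_totally_bounded by blast
  obtain \<phi> where \<phi>: "\<And>x::'a. bounded_linear (\<phi> x)" "\<And>x. \<phi> x x = norm x" "\<And>x y. \<bar>\<phi> x y\<bar> \<le> norm y"
    using norming_functional by metis
  have "\<forall>x\<in>k. \<forall>\<^sub>F i in sequentially. \<bar>\<phi> x (w i)\<bar> < \<delta>"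
  proof
    fix x
    have "(\<lambda>i. \<phi> x (w i)) \<longlonglongrightarrow> 0"
      using assms(2) \<phi>(1) by (simp add: weakly_null_def)
    from tendstoD[OF this \<delta>(1)] show "\<forall>\<^sub>F i in sequentially. \<bar>\<phi> x (w i)\<bar> < \<delta>"
      by (simp add: dist_real_def)
  qed
  then have "\<forall>\<^sub>F i in sequentially. \<forall>x\<in>k. \<bar>\<phi> x (w i)\<bar> < \<delta>"
    using k(1) by (simp add: eventually_ball_finite)
  with low show ?thesis
  proof eventually_elim
    case (elim i)
    have unit: "1 \<le> \<theta> * norm (v + t *\<^sub>R w i)" if v: "v \<in> span B" "norm v = 1" for v t
    \<comment> \<open>Large multiples need no functional: \<open>t *\<^sub>R w i\<close> then has
      norm at least 2, which exceeds \<open>norm v\<close> by 1.\<close>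
    proof (cases "4 \<le> \<bar>t\<bar>")
      case True
      have "2 \<le> \<bar>t\<bar> * norm (w i)"
        using mult_mono[OF True elim(1)] by simp
      then have "1 \<le> norm (v + t *\<^sub>R w i)"
        using norm_diff_ineq[of "t *\<^sub>R w i" v] v(2) by (simp add: add.commute)
      then show ?thesis
        using mult_mono[of 1 \<theta> 1 "norm (v + t *\<^sub>R w i)"] assms(4) by simp
    next
      case False
      from v have "v \<in> cball 0 1 \<inter> span B" by simp
      with k(2) have "v \<in> (\<Union>x\<in>k. ball x \<delta>)" by (rule subsetD)
      then obtain x where x: "x \<in> k" "norm (x - v) < \<delta>"
        by (auto simp: dist_norm)
      interpret bounded_linear "\<phi> x" by (rule \<phi>(1))
      have "\<bar>t * \<phi> x (w i)\<bar> \<le> 4 * \<delta>"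
        using mult_mono[of "\<bar>t\<bar>" 4 "\<bar>\<phi> x (w i)\<bar>" \<delta>] False elim(2) x(1) \<delta>(1)
        by (simp add: abs_mult less_imp_le)
      moreover have "\<phi> x (v + t *\<^sub>R w i) = norm x - \<phi> x (x - v) + t * \<phi> x (w i)"
        using \<phi>(2)[of x] by (simp add: add diff scale)
      moreover have "\<bar>\<phi> x (x - v)\<bar> \<le> \<delta>" "\<bar>\<phi> x (v + t *\<^sub>R w i)\<bar> \<le> norm (v + t *\<^sub>R w i)"
        using order_trans[OF \<phi>(3) less_imp_le[OF x(2)]] \<phi>(3) by blast+
      moreover have "1 - \<delta> \<le> norm x"
        using norm_triangle_ineq2[of v x] x(2) v(2) by (simp add: norm_minus_commute)
      ultimately have "1 - 6 * \<delta> \<le> norm (v + t *\<^sub>R w i)" by linarith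
      then show ?thesis
        using assms(4) unfolding \<delta>(2) by (simp add: field_simps)
    qed
    show ?case
    proof (intro ballI allI)
      fix v t assume v: "v \<in> span B"
      show "norm v \<le> \<theta> * norm (v + t *\<^sub>R w i)"
      proof (cases "v = 0")
        case False
        have "1 \<le> \<theta> * norm (inverse (norm v) *\<^sub>R v + (inverse (norm v) * t) *\<^sub>R w i)"
          using False v by (intro unit) (auto intro: span_scale)
        also have "inverse (norm v) *\<^sub>R v + (inverse (norm v) * t) *\<^sub>R w i
            = inverse (norm v) *\<^sub>R (v + t *\<^sub>R w i)"
          by (simp add: scaleR_add_right)
        finally have "1 \<le> \<theta> * (inverse (norm v) * norm (v + t *\<^sub>R w i))"
          by simp
        then show ?thesis
          using False by (simp add: field_simps)
      qed (use assms(4) in simp)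
    qed
  qed
qed

subsection \<open>Uniform convergence to an asymptotic model\<close>

text \<open>Each threshold may depend on the earlier indices. Starting the rest of the tuple at
  \<open>Suc i\<close> forces it to increase strictly.\<close>

lemma iter_eventuallyI:
  assumes "\<And>is. length is = n \<Longrightarrow> sorted_wrt (<) is \<Longrightarrow> (\<forall>s\<in>set is. N \<le> s) \<Longrightarrow> P is"
  shows "iter_eventually n P"
  using assms
proof (induction n arbitrary: N P)
  case (Suc n)
  have "iter_eventually n (\<lambda>is. P (i # is))" if "N \<le> i" for i
    by (rule Suc.IH[of "Suc i"]) (use that in \<open>force intro!: Suc.prems\<close>)
  then show ?case
    by (auto simp: eventually_sequentially)
qed simp

text \<open>The increasing tuples beyond \<open>N\<close> are themselves iterated-eventual. If none
  of them satisfied \<open>P\<close>, then \<open>False\<close> would hold iterated-eventually,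
  which is impossible.\<close>

lemma iter_eventually_obtain:
  assumes "iter_eventually n P"
  obtains "is" where "P is" "length is = n" "sorted_wrt (<) is" "\<forall>s\<in>set is. N \<le> s"
proof -
  have "iter_eventually n (\<lambda>is. length is = n \<and> sorted_wrt (<) is \<and> (\<forall>s\<in>set is. N \<le> s))"
    by (rule iter_eventuallyI) auto
  note both = iter_eventually_conj[OF assms this]
  show thesis
  proof (rule ccontr)
    assume "\<not> thesis"
    with both have "iter_eventually n (\<lambda>_. False)"
      by - (rule iter_eventually_mono[OF both], use that in blast)
    then show False by (simp add: iter_eventually_const)
  qed
qed

lemma strict_mono_on_nth:
  fixes "is" :: "nat list"
  assumes "sorted_wrt (<) is" "length is = n"
  shows "strict_mono_on {..<n} ((!) is)"
  using assms by (auto simp: strict_mono_on_def sorted_wrt_iff_nth_less)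

text \<open>The estimates for an asymptotic model tie the number of indices to their lower bound. A
  shorter tuple far out is brought into that form by padding, to be used with zero
  coefficients.\<close>

lemma admissible_extend:
  assumes "strict_mono_on {..<q} i" "\<And>l. l < q \<Longrightarrow> n \<le> i l"
  obtains i' where "admissible n i'" "\<And>l. l < q \<Longrightarrow> i' l = i l"
proof -
  \<comment> \<open>The sum dominates every given index, \<open>Suc\<close> makes the step at
    \<open>q\<close> strict, and \<open>+ l\<close> keeps the padding increasing.\<close>
  define i' where "i' l = (if l < q then i l else Suc (n + (\<Sum>j<q. i j) + l))" for l
  have big: "i l < Suc (n + (\<Sum>j<q. i j) + m)" if "l < q" for l m
    using member_le_sum[of l "{..<q}" i] that by simp
  have "admissible n i'"
    unfolding admissible_def
  proof (intro conjI strict_mono_onI allI impI)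
    fix r s :: nat assume "r < s"
    then show "i' r < i' s"
      using assms(1) big by (auto simp: i'_def strict_mono_on_def)
  qed (use assms(2) in \<open>auto simp: i'_def\<close>)
  then show thesis
    by (rule that) (simp add: i'_def)
qed

lemma sum_extend_by_zero:
  fixes g :: "nat \<Rightarrow> 'a::real_vector"
  assumes "q \<le> n"
  shows "(\<Sum>l<n. (if l < q then c l else 0) *\<^sub>R g l) = (\<Sum>l<q. c l *\<^sub>R g l)"
  using assms by (intro sum.mono_neutral_cong_right) auto

text \<open>The iterated limit provides one tuple with norm close to the limit, and the generating
  condition compares every other far tuple with it. The tuple may depend on \<open>c\<close>, the
  threshold does not: it only uses the bound \<open>C\<close>, by which the coefficients are
  rescaled.\<close>

lemma asymptotic_model_uniform_limit:
  fixes x :: "nat \<Rightarrow> nat \<Rightarrow> 'a::banach" and e :: "nat \<Rightarrow> 'b::banach"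
  assumes model: "asymptotic_model_generated_by e x" and "0 < \<eta>"
  shows "\<forall>\<^sub>F N in sequentially. \<forall>c i. (\<forall>l<q. \<bar>c l\<bar> \<le> C) \<longrightarrow> (\<forall>l<q. N \<le> i l) \<longrightarrow>
    strict_mono_on {..<q} i \<longrightarrow>
    \<bar>norm (\<Sum>l<q. c l *\<^sub>R x l (i l)) - norm (\<Sum>l<q. c l *\<^sub>R e l)\<bar> \<le> \<eta>"
proof -
  define D where "D = 1 + \<bar>C\<bar>"
  have D: "D \<ge> 1" "C \<le> D" by (auto simp: D_def)
  obtain \<epsilon> :: "nat \<Rightarrow> real" where \<epsilon>: "\<epsilon> \<longlonglongrightarrow> 0" and
    close: "\<And>n b i l. (\<forall>j<n. b j \<in> {-1..1}) \<Longrightarrow> admissible n i \<Longrightarrow> admissible n l \<Longrightarrow>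
      \<bar>norm (\<Sum>j<n. b j *\<^sub>R x j (i j)) - norm (\<Sum>j<n. b j *\<^sub>R x j (l j))\<bar> < \<epsilon> n"
    using model unfolding asymptotic_model_generated_by_def generates_asymptotic_model_def by blast
  have "(\<lambda>n. D * \<epsilon> n) \<longlonglongrightarrow> 0"
    using tendsto_mult_left[OF \<epsilon>, of D] by simp
  from tendstoD[OF this half_gt_zero[OF assms(2)]]
  have "\<forall>\<^sub>F n in sequentially. \<bar>D * \<epsilon> n\<bar> < \<eta> / 2"
    by (simp only: dist_real_def diff_0_right)
  with eventually_ge_at_top[of q] show ?thesis
  proof eventually_elim
    case (elim n)
    \<comment> \<open>Here \<open>n\<close> is both the threshold for the indices and the length to
      which the sums of \<open>q\<close> terms are padded.\<close>
    have two: "\<bar>norm (\<Sum>l<q. c l *\<^sub>R x l (i l)) - norm (\<Sum>l<q. c l *\<^sub>R x l (k l))\<bar> \<le> \<eta> / 2"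
      if c: "\<forall>l<q. \<bar>c l\<bar> \<le> C" and i: "\<forall>l<q. n \<le> i l" "strict_mono_on {..<q} i"
        and k: "\<forall>l<q. n \<le> k l" "strict_mono_on {..<q} k" for c i k
    proof -
      obtain i' where i': "admissible n i'" "\<And>l. l < q \<Longrightarrow> i' l = i l"
        using admissible_extend[of q i n] i by auto
      obtain k' where k': "admissible n k'" "\<And>l. l < q \<Longrightarrow> k' l = k l"
        using admissible_extend[of q k n] k by auto
      let ?b = "\<lambda>l. if l < q then c l / D else 0"
      have b: "\<forall>l<n. ?b l \<in> {-1..1}"
      proof (intro allI impI)
        fix l
        have "\<bar>?b l\<bar> \<le> 1"
          using c D by (auto simp: abs_divide dest!: spec[of _ l])
        then show "?b l \<in> {-1..1}" by (metis abs_le_D1 abs_le_D2 atLeastAtMost_iff minus_le_iff)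
      qed
      have scale: "norm (\<Sum>l<n. ?b l *\<^sub>R x l (i' l)) = norm (\<Sum>l<q. c l *\<^sub>R x l (i l)) / D"
        if "\<And>l. l < q \<Longrightarrow> i' l = i l" for i i'
      proof -
        have "(\<Sum>l<n. ?b l *\<^sub>R x l (i' l)) = (\<Sum>l<q. (c l / D) *\<^sub>R x l (i' l))"
          using elim(1) by (rule sum_extend_by_zero)
        also have "\<dots> = inverse D *\<^sub>R (\<Sum>l<q. c l *\<^sub>R x l (i l))"
          unfolding scaleR_sum_right using that by (intro sum.cong) (auto simp: field_simps)
        finally show ?thesis
          using D(1) by (simp add: field_simps)
      qed
      have "\<bar>norm (\<Sum>l<q. c l *\<^sub>R x l (i l)) / D - norm (\<Sum>l<q. c l *\<^sub>R x l (k l)) / D\<bar> < \<epsilon> n"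
        using close[OF b i'(1) k'(1)] scale[OF i'(2)] scale[OF k'(2)] by simp
      then have "\<bar>norm (\<Sum>l<q. c l *\<^sub>R x l (i l)) - norm (\<Sum>l<q. c l *\<^sub>R x l (k l))\<bar> < D * \<epsilon> n"
        using D(1) by (simp add: diff_divide_distrib[symmetric] abs_divide field_simps)
      then show ?thesis
        using elim(2) by linarith
    qed
    show ?case
    proof (intro allI impI)
      fix c i assume c: "\<forall>l<q. \<bar>c l\<bar> \<le> C" and i: "\<forall>l<q. n \<le> i l" "strict_mono_on {..<q} i"
      have "iter_eventually q
        (\<lambda>is. \<bar>norm (\<Sum>j<q. c j *\<^sub>R x j (is ! j)) - norm (\<Sum>j<q. c j *\<^sub>R e j)\<bar> < \<eta> / 2)"
        using model half_gt_zero[OF assms(2)]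
        unfolding asymptotic_model_generated_by_def iterated_limit_def by blast
      then obtain "is" where "is": "length is = q" "sorted_wrt (<) is" "\<forall>s\<in>set is. n \<le> s"
        and lim: "\<bar>norm (\<Sum>j<q. c j *\<^sub>R x j (is ! j)) - norm (\<Sum>j<q. c j *\<^sub>R e j)\<bar> < \<eta> / 2"
        by (rule iter_eventually_obtain[where N = n])
      have "\<forall>l<q. n \<le> is ! l"
        using "is" by auto
      from two[OF c i this strict_mono_on_nth[OF "is"(2,1)]] lim
      show "\<bar>norm (\<Sum>l<q. c l *\<^sub>R x l (i l)) - norm (\<Sum>l<q. c l *\<^sub>R e l)\<bar> \<le> \<eta>"
        by linarith
    qed
  qed
qed

text \<open>Padding a fixed sum with zeros to length \<open>N\<close> improves the error from
  \<open>\<eta> n\<close> to \<open>\<eta> N\<close>, up to a factor for the size of the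
  coefficients. This yields the iterated limit.\<close>

lemma asymptotic_model_generated_byI:
  fixes y :: "nat \<Rightarrow> nat \<Rightarrow> 'a::banach" and f :: "nat \<Rightarrow> 'b::banach" and \<eta> :: "nat \<Rightarrow> real"
  assumes "basic_array y" and pos: "\<And>n. 0 < \<eta> n" and "decseq \<eta>" and lim: "\<eta> \<longlonglongrightarrow> 0"
    and close: "\<And>n b i. (\<forall>j<n. \<bar>b j\<bar> \<le> 1) \<Longrightarrow> admissible n i \<Longrightarrow>
      \<bar>norm (\<Sum>j<n. b j *\<^sub>R y j (i j)) - norm (\<Sum>j<n. b j *\<^sub>R f j)\<bar> \<le> \<eta> n"
  shows "asymptotic_model_generated_by f y"
  unfolding asymptotic_model_generated_by_def generates_asymptotic_model_def
\<comment> \<open>Two comparisons with \<open>f\<close> cost \<open>2 * \<eta> n\<close>; the factor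
  3 makes the inequality strict.\<close>
proof (intro conjI allI exI[of _ "\<lambda>n. 3 * \<eta> n"] impI)
  show "(\<lambda>n. 3 * \<eta> n) \<longlonglongrightarrow> 0"
    using tendsto_mult_left[OF lim, of 3] by simp
next
  fix n and b :: "nat \<Rightarrow> real" and i l
  assume A: "(\<forall>j<n. b j \<in> {-1..1}) \<and> admissible n i \<and> admissible n l"
  then have "\<forall>j<n. \<bar>b j\<bar> \<le> 1" by (auto simp: abs_le_iff)
  from close[OF this, of i] close[OF this, of l] A
  show "\<bar>norm (\<Sum>j<n. b j *\<^sub>R y j (i j)) - norm (\<Sum>j<n. b j *\<^sub>R y j (l j))\<bar> < 3 * \<eta> n"
    using pos[of n] by linarith
next
  fix n and b :: "nat \<Rightarrow> real"
  define D where "D = 1 + (\<Sum>j<n. \<bar>b j\<bar>)"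
  have D: "D \<ge> 1" by (simp add: D_def sum_nonneg)
  have b: "\<bar>b j\<bar> \<le> D" if "j < n" for j
    using member_le_sum[of j "{..<n}" "\<lambda>j. \<bar>b j\<bar>"] that by (simp add: D_def)
  show "iterated_limit n (\<lambda>is. norm (\<Sum>j<n. b j *\<^sub>R y j (is ! j))) (norm (\<Sum>j<n. b j *\<^sub>R f j))"
    unfolding iterated_limit_def
  proof (intro allI impI)
    fix \<epsilon> :: real assume "0 < \<epsilon>"
    have "(\<lambda>n. D * \<eta> n) \<longlonglongrightarrow> 0"
      using tendsto_mult_left[OF lim, of D] by simp
    from tendstoD[OF this \<open>0 < \<epsilon>\<close>]
    have "\<forall>\<^sub>F N in sequentially. n \<le> N \<and> D * \<eta> N < \<epsilon>"
      using eventually_ge_at_top[of n] by eventually_elim (simp add: dist_real_def)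
    then obtain N where N: "n \<le> N" "D * \<eta> N < \<epsilon>"
      by (auto simp: eventually_sequentially)
    show "iter_eventually n
      (\<lambda>is. \<bar>norm (\<Sum>j<n. b j *\<^sub>R y j (is ! j)) - norm (\<Sum>j<n. b j *\<^sub>R f j)\<bar> < \<epsilon>)"
    proof (rule iter_eventuallyI[where N = N])
      fix "is" :: "nat list"
      assume "is": "length is = n" "sorted_wrt (<) is" "\<forall>s\<in>set is. N \<le> s"
      obtain i where i: "admissible N i" "\<And>l. l < n \<Longrightarrow> i l = is ! l"
        using admissible_extend[OF strict_mono_on_nth[OF "is"(2,1)], of N] "is" by auto
      let ?b = "\<lambda>j. if j < n then b j / D else 0"
      have "\<forall>j<N. \<bar>?b j\<bar> \<le> 1"
        using b D by (simp add: abs_divide)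
      note c = close[OF this i(1)]
      have scale: "norm (\<Sum>j<N. ?b j *\<^sub>R g j) = norm (\<Sum>j<n. b j *\<^sub>R h j) / D"
        if "\<And>j. j < n \<Longrightarrow> g j = h j" for g h :: "nat \<Rightarrow> 'c::real_normed_vector"
      proof -
        have "(\<Sum>j<N. ?b j *\<^sub>R g j) = (\<Sum>j<n. (b j / D) *\<^sub>R g j)"
          using N(1) by (rule sum_extend_by_zero)
        also have "\<dots> = inverse D *\<^sub>R (\<Sum>j<n. b j *\<^sub>R h j)"
          unfolding scaleR_sum_right using that by (intro sum.cong) (auto simp: field_simps)
        finally show ?thesis
          using D by (simp add: field_simps)
      qed
      have "norm (\<Sum>j<N. ?b j *\<^sub>R y j (i j)) = norm (\<Sum>j<n. b j *\<^sub>R y j (is ! j)) / D"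
        "norm (\<Sum>j<N. ?b j *\<^sub>R f j) = norm (\<Sum>j<n. b j *\<^sub>R f j) / D"
        using i(2) by (intro scale; simp)+
      with c have "\<bar>norm (\<Sum>j<n. b j *\<^sub>R y j (is ! j)) / D - norm (\<Sum>j<n. b j *\<^sub>R f j) / D\<bar> \<le> \<eta> N"
        by simp
      then have "\<bar>norm (\<Sum>j<n. b j *\<^sub>R y j (is ! j)) - norm (\<Sum>j<n. b j *\<^sub>R f j)\<bar> \<le> D * \<eta> N"
        using D by (simp add: diff_divide_distrib[symmetric] abs_divide field_simps)
      with N(2) show "\<bar>norm (\<Sum>j<n. b j *\<^sub>R y j (is ! j)) - norm (\<Sum>j<n. b j *\<^sub>R f j)\<bar> < \<epsilon>"
        by linarith
    qed
  qed
qed (use assms in \<open>auto simp: decseq_def\<close>)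

subsection \<open>Blocks\<close>

definition block_index :: "(nat \<Rightarrow> nat) \<Rightarrow> nat \<Rightarrow> nat" where
  "block_index p l = (LEAST j. l < p (Suc j))"

lemma block_index_eq:
  assumes "strict_mono p" "p j \<le> l" "l < p (Suc j)"
  shows "block_index p l = j"
  unfolding block_index_def
proof (rule Least_equality)
  fix k assume "l < p (Suc k)"
  with assms(2) have "p j < p (Suc k)" by simp
  then show "j \<le> k"
    using assms(1) by (simp add: strict_mono_less)
qed (rule assms(3))

lemma block_index_bounds:
  assumes "strict_mono p" "p 0 = 0"
  shows "p (block_index p l) \<le> l" "l < p (Suc (block_index p l))"
proof -
  have "l < p (Suc l)"
    using strict_mono_imp_increasing[OF assms(1), of "Suc l"] by simp
  then show "l < p (Suc (block_index p l))"
    unfolding block_index_def by (rule LeastI)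
  show "p (block_index p l) \<le> l"
  proof (cases "block_index p l")
    case (Suc k)
    then have "\<not> l < p (Suc k)"
      using not_less_Least[of k "\<lambda>j. l < p (Suc j)"] by (simp add: block_index_def)
    then show ?thesis by (simp add: Suc)
  qed (simp add: assms(2))
qed

lemma block_index_less:
  assumes "strict_mono p" "p 0 = 0" "l < p n"
  shows "block_index p l < n"
  using block_index_bounds(1)[OF assms(1,2), of l] assms(3) strict_mono_less[OF assms(1)]
  by (metis le_less_trans)

lemma block_index_mono:
  assumes "strict_mono p" "p 0 = 0" "l \<le> k"
  shows "block_index p l \<le> block_index p k"
proof -
  have "p (block_index p l) < p (Suc (block_index p k))"
    using block_index_bounds[OF assms(1,2)] assms(3) by (meson le_less_trans)
  then show ?thesis
    using strict_mono_less[OF assms(1)] by auto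
qed

text \<open>The vectors \<open>h j l\<close> may depend on the block \<open>j\<close>, because
  distinct blocks will be shifted by different amounts; \<open>block_index\<close> recovers the
  block after flattening.\<close>

lemma sum_over_blocks:
  fixes h :: "nat \<Rightarrow> nat \<Rightarrow> 'a::real_vector"
  assumes "strict_mono p" "p 0 = 0"
  shows "(\<Sum>j<n. g j *\<^sub>R (\<Sum>l = p j..<p (Suc j). b l *\<^sub>R h j l)) =
    (\<Sum>l<p n. (g (block_index p l) * b l) *\<^sub>R h (block_index p l) l)"
proof (induction n)
  case (Suc n)
  have "g n *\<^sub>R (\<Sum>l = p n..<p (Suc n). b l *\<^sub>R h n l) =
      (\<Sum>l = p n..<p (Suc n). (g (block_index p l) * b l) *\<^sub>R h (block_index p l) l)"
    unfolding scaleR_sum_right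
    by (intro sum.cong) (auto simp: block_index_eq[OF assms(1)])
  moreover have "{..<p (Suc n)} = {..<p n} \<union> {p n..<p (Suc n)}"
    using strict_monoD[OF assms(1), of n "Suc n"] by auto
  ultimately show ?case
    using Suc by (simp add: sum.union_disjoint ivl_disj_int)
qed (use assms(2) in simp)

lemma K_basic_seq_scale:
  assumes "K_basic_seq K N z" "\<And>i. s i \<noteq> (0 :: real)"
  shows "K_basic_seq K N (\<lambda>i. s i *\<^sub>R z i)"
  unfolding K_basic_seq_def
proof (intro conjI allI impI)
  fix n m :: nat and a :: "nat \<Rightarrow> real"
  assume "n < m \<and> enat m \<le> N"
  then show "norm (\<Sum>i<n. a i *\<^sub>R s i *\<^sub>R z i) \<le> K * norm (\<Sum>i<m. a i *\<^sub>R s i *\<^sub>R z i)"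
    using assms(1)[unfolded K_basic_seq_def, THEN conjunct2, rule_format, of n m "\<lambda>i. a i * s i"]
    by simp
qed (use assms in \<open>simp add: K_basic_seq_def\<close>)

lemma K_basic_seq_mono:
  assumes "K_basic_seq K N z" "K \<le> L"
  shows "K_basic_seq L N z"
  using assms unfolding K_basic_seq_def by (meson mult_right_mono norm_ge_zero order_trans)

section \<open>Diagonal blocks of an array\<close>

definition diagonal_block ::
  "(nat \<Rightarrow> nat \<Rightarrow> 'a::real_vector) \<Rightarrow> (nat \<Rightarrow> nat) \<Rightarrow> (nat \<Rightarrow> real) \<Rightarrow> nat \<Rightarrow> nat \<Rightarrow> 'a" where
  "diagonal_block x p b k N = (\<Sum>l = p k..<p (Suc k). b l *\<^sub>R x l (N + l))"

lemma diagonal_block_as_sum: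
  "diagonal_block x p b k N = (\<Sum>l<p (Suc k). (if p k \<le> l then b l else 0) *\<^sub>R x l (N + l))"
  unfolding diagonal_block_def by (intro sum.mono_neutral_cong_left) auto

lemma diagonal_block_norm_eventually:
  fixes x :: "nat \<Rightarrow> nat \<Rightarrow> 'a::banach" and e :: "nat \<Rightarrow> 'b::banach"
  assumes "asymptotic_model_generated_by e x" and "0 < \<eta>"
  shows "\<forall>\<^sub>F N in sequentially.
    \<bar>norm (diagonal_block x p b k N) - norm (\<Sum>l = p k..<p (Suc k). b l *\<^sub>R e l)\<bar> \<le> \<eta>"
  using asymptotic_model_uniform_limit[OF assms, of "p (Suc k)" "\<Sum>l<p (Suc k). \<bar>b l\<bar>"]
proof eventually_elim
  case (elim N)
  have e: "(\<Sum>l = p k..<p (Suc k). b l *\<^sub>R e l) =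
      (\<Sum>l<p (Suc k). (if p k \<le> l then b l else 0) *\<^sub>R e l)"
    by (intro sum.mono_neutral_cong_left) auto
  have "\<forall>l<p (Suc k). \<bar>if p k \<le> l then b l else 0\<bar> \<le> (\<Sum>l<p (Suc k). \<bar>b l\<bar>)"
    using member_le_sum[of _ "{..<p (Suc k)}" "\<lambda>l. \<bar>b l\<bar>"] by (auto intro!: sum_nonneg)
  moreover have "strict_mono_on {..<p (Suc k)} (\<lambda>l. N + l)"
    by (simp add: strict_mono_on_def)
  ultimately show ?case
    unfolding diagonal_block_as_sum e by (intro elim[rule_format]) auto
qed

text \<open>\<open>Q\<close> collects the requirements on successive terms of \<open>M\<close> that make the rows basic.\<close>

lemma asymptotic_model_of_blocks:
  fixes x :: "nat \<Rightarrow> nat \<Rightarrow> 'a::banach" and e f :: "nat \<Rightarrow> 'b::banach"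
  assumes model: "asymptotic_model_generated_by e x"
    and p: "strict_mono p" "p 0 = 0"
    and f: "\<And>k. f k = (\<Sum>l = p k..<p (Suc k). b l *\<^sub>R e l)" "\<And>k. norm (f k) = 1"
    and Q: "\<And>i N0. \<forall>\<^sub>F N in sequentially. Q i N0 N"
    and rows: "\<And>M. (\<And>i. Q i (M i) (M (Suc i))) \<Longrightarrow>
      (\<And>k i. k \<le> i \<Longrightarrow> diagonal_block x p b k (M i) \<noteq> 0) \<Longrightarrow>
      \<exists>K. \<forall>k. K_basic_seq K \<infinity> (\<lambda>i. diagonal_block x p b k (M (k + i)))"
  shows "asymptotic_model_of TYPE('a) f"
proof -
  let ?u = "diagonal_block x p b"
  \<comment> \<open>Normalizing \<open>n\<close> blocks costs \<open>n * \<delta> n\<close> and the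
    comparison with \<open>f\<close> another \<open>\<delta> n\<close>; the square keeps the total
    below \<open>1 / (real n + 2)\<close>.\<close>
  define \<delta> :: "nat \<Rightarrow> real" where "\<delta> i = 1 / (real i + 2)\<^sup>2" for i
  define C where "C i = (\<Sum>l<p (Suc i). \<bar>b l\<bar>)" for i
  define P where "P i N \<longleftrightarrow> (\<forall>q\<in>{..p (Suc i)}. \<forall>c h. (\<forall>l<q. \<bar>c l\<bar> \<le> C i) \<longrightarrow> (\<forall>l<q. N \<le> h l) \<longrightarrow>
      strict_mono_on {..<q} h \<longrightarrow>
      \<bar>norm (\<Sum>l<q. c l *\<^sub>R x l (h l)) - norm (\<Sum>l<q. c l *\<^sub>R e l)\<bar> \<le> \<delta> i) \<and>
    (\<forall>k\<in>{..i}. \<bar>norm (?u k N) - 1\<bar> \<le> \<delta> i)" for i N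
  have \<delta>_pos: "\<delta> i > 0" for i by (simp add: \<delta>_def)
  have \<delta>_less: "\<delta> i < 1" for i
    using power_strict_mono[of 1 "real i + 2" 2] by (simp add: \<delta>_def field_simps)
  have evP: "\<forall>\<^sub>F N in sequentially. P i N" for i
    unfolding P_def
    using asymptotic_model_uniform_limit[OF model \<delta>_pos]
      diagonal_block_norm_eventually[OF model \<delta>_pos[of i], of p b, folded f(1), unfolded f(2)]
    by (auto intro!: eventually_conj eventually_ball_finite)
  \<comment> \<open>The gap \<open>p (Suc i)\<close> exceeds the spread of columns within the blocks
    used at stage \<open>i\<close>, so successive blocks of a diagonal occupy increasing columns of
    \<open>x\<close>.\<close>
  obtain M where M: "\<And>i. P i (M i)" "\<And>i. Q i (M i) (M (Suc i))"
    and M_gap: "\<And>i. M i + p (Suc i) \<le> M (Suc i)"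
  proof -
    have "\<exists>M. \<forall>i. P i (M i) \<and> (Q i (M i) (M (Suc i)) \<and> M i + p (Suc i) \<le> M (Suc i))"
    proof (rule dependent_nat_choice)
      show "\<exists>N. P 0 N"
        using evP[of 0] by (auto simp: eventually_sequentially)
      fix N0 i
      have "\<forall>\<^sub>F N in sequentially. P (Suc i) N \<and> (Q i N0 N \<and> N0 + p (Suc i) \<le> N)"
        using evP Q eventually_ge_at_top by (intro eventually_conj)
      then show "\<exists>N. P (Suc i) N \<and> (Q i N0 N \<and> N0 + p (Suc i) \<le> N)"
        by (auto simp: eventually_sequentially)
    qed
    with that show thesis by blast
  qed
  have p_less: "p i < p (Suc i)" for i
    using p(1) by (simp add: strict_mono_less)
  have M_less: "M i < M (Suc i)" for i
    using M_gap[of i] p_less[of i] by linarith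
  then have M_strict: "strict_mono M"
    by (simp add: strict_mono_Suc_iff)
  have M_gap': "M i + p (Suc i) \<le> M j" if "i < j" for i j
    using M_gap[of i] strict_mono_leD[OF M_strict, of "Suc i" j] that by linarith
  \<comment> \<open>A diagonal of \<open>m\<close> new entries unfolds into \<open>p m\<close>
    entries of \<open>x\<close>, which are admissible only from column \<open>p m\<close>
    on.\<close>
  have p_le_M: "p m \<le> M m" for m
    using M_gap[of "m - 1"] p(2) by (cases m) auto
  have u_norm: "\<bar>norm (?u k (M i)) - 1\<bar> \<le> \<delta> i" if "k \<le> i" for k i
    using M(1)[of i] that by (simp add: P_def)
  have u_nonzero: "?u k (M i) \<noteq> 0" if "k \<le> i" for k i
    using u_norm[OF that] \<delta>_less[of i] by auto
  \<comment> \<open>The shift by \<open>k\<close> is there because \<open>M i\<close> controls only the blocks \<open>k \<le> i\<close>, while the whole row has to be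
    basic.\<close>
  define y where "y k i = inverse (norm (?u k (M (k + i)))) *\<^sub>R ?u k (M (k + i))" for k i

  \<comment> \<open>This is the column in which row \<open>l\<close> of \<open>x\<close> is met when
    the diagonal \<open>i\<close> of the new array is flattened.\<close>
  define h where "h i l = M (block_index p l + i (block_index p l)) + l" for i l
  have h: "strict_mono_on {..<p m} (h i)" "\<And>l. l < p m \<Longrightarrow> M m \<le> h i l"
    if "admissible m i" for m i
  proof -
    have i: "\<And>j. j < m \<Longrightarrow> m \<le> i j" "\<And>j k. j < k \<Longrightarrow> k < m \<Longrightarrow> i j < i k"
      using that by (auto simp: admissible_def strict_mono_on_def)
    show "M m \<le> h i l" if l: "l < p m" for l
    proof -
      have "m \<le> block_index p l + i (block_index p l)"
        using i(1)[OF block_index_less[OF p l]] by simp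
      from strict_mono_leD[OF M_strict this] show ?thesis
        by (simp add: h_def)
    qed
    show "strict_mono_on {..<p m} (h i)"
    proof (rule strict_mono_onI)
      fix l k assume lk: "l \<in> {..<p m}" "k \<in> {..<p m}" "l < k"
      let ?r = "block_index p l" and ?s = "block_index p k"
      have "?r \<le> ?s"
        using block_index_mono[OF p] lk(3) by simp
      show "h i l < h i k"
      proof (cases "?r = ?s")
        case True
        then show ?thesis using lk(3) by (simp add: h_def)
      next
        case False
        with \<open>?r \<le> ?s\<close> have "?r < ?s" by simp
        then have "?r + i ?r < ?s + i ?s"
          using i(2)[of ?r ?s] block_index_less[OF p, of k m] lk(2) by simp
        then have "M (?r + i ?r) + p (Suc (?r + i ?r)) \<le> M (?s + i ?s)"
          by (rule M_gap')
        moreover have "l < p (Suc (?r + i ?r))"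
          using block_index_bounds(2)[OF p, of l] strict_mono_leD[OF p(1), of "Suc ?r" "Suc (?r + i ?r)"]
          by simp
        ultimately show ?thesis
          using lk(3) by (simp add: h_def)
      qed
    qed
  qed
  have u_sum: "(\<Sum>j<n. g j *\<^sub>R ?u j (M (j + i j))) =
      (\<Sum>l<p n. (g (block_index p l) * b l) *\<^sub>R x l (h i l))" for n g i
    unfolding diagonal_block_def h_def
    using sum_over_blocks[OF p, where n = n and g = g and b = b and h = "\<lambda>j l. x l (M (j + i j) + l)"] by simp
  have f_sum: "(\<Sum>j<n. g j *\<^sub>R f j) = (\<Sum>l<p n. (g (block_index p l) * b l) *\<^sub>R e l)" for n g
    unfolding f(1) by (rule sum_over_blocks[OF p])

  obtain Kr where Kr: "\<And>k. K_basic_seq Kr \<infinity> (\<lambda>i. ?u k (M (k + i)))"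
    using rows[OF M(2) u_nonzero] by blast
  obtain Kx where Kx: "K_basic_array Kx x"
    using model by (auto simp: asymptotic_model_generated_by_def generates_asymptotic_model_def basic_array_def)

  \<comment> \<open>Partial sums of the new diagonal are partial sums of an admissible diagonal of
    \<open>x\<close>, cut at ends of blocks, so the constant \<open>Kx\<close> is inherited.\<close>
  have diag: "K_basic_seq Kx (enat m) (\<lambda>j. ?u j (M (j + i j)))" if adm: "admissible m i" for m i
  proof -
    obtain i' where i': "admissible (p m) i'" "\<And>l. l < p m \<Longrightarrow> i' l = h i l"
      using admissible_extend[OF h(1)[OF adm], of "p m"] h(2)[OF adm] p_le_M[of m] order_trans by metis
    then have K: "K_basic_seq Kx (enat (p m)) (\<lambda>l. x l (i' l))"
      using Kx by (simp add: K_basic_array_def)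
    show ?thesis
      unfolding K_basic_seq_def
    proof (intro conjI allI impI)
      fix n m' :: nat and a :: "nat \<Rightarrow> real"
      assume "n < m' \<and> enat m' \<le> enat m"
      then have nm: "n < m'" "m' \<le> m" by auto
      have le: "p k \<le> p m" if "k \<le> m" for k
        using strict_mono_leD[OF p(1) that] .
      have eq: "(\<Sum>j<k. a j *\<^sub>R ?u j (M (j + i j))) =
          (\<Sum>l<p k. (a (block_index p l) * b l) *\<^sub>R x l (i' l))" if "k \<le> m" for k
        unfolding u_sum using i'(2) le[OF that] by (intro sum.cong) auto
      show "norm (\<Sum>j<n. a j *\<^sub>R ?u j (M (j + i j))) \<le>
          Kx * norm (\<Sum>j<m'. a j *\<^sub>R ?u j (M (j + i j)))"
        unfolding eq[OF nm(2)] eq[OF less_imp_le[OF less_le_trans[OF nm]]]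
        by (rule K[unfolded K_basic_seq_def, THEN conjunct2, rule_format])
          (use nm le p(1) in \<open>simp add: strict_mono_less\<close>)
    qed (simp add: u_nonzero)
  qed

  have "K_basic_array (max Kr Kx) y"
    unfolding K_basic_array_def
  proof (intro conjI allI impI)
    show "norm (y n i) = 1" for n i
      by (simp add: y_def u_nonzero)
    show "K_basic_seq (max Kr Kx) \<infinity> (y n)" for n
    proof (rule K_basic_seq_mono)
      show "K_basic_seq Kr \<infinity> (y n)"
        unfolding y_def[abs_def] by (rule K_basic_seq_scale[OF Kr]) (simp add: u_nonzero)
    qed simp
    show "K_basic_seq (max Kr Kx) (enat m) (\<lambda>j. y j (i j))" if "admissible m i" for m i
    proof (rule K_basic_seq_mono)
      show "K_basic_seq Kx (enat m) (\<lambda>j. y j (i j))"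
        unfolding y_def by (rule K_basic_seq_scale[OF diag[OF that]]) (simp add: u_nonzero)
    qed simp
  qed
  then have "basic_array y" by (auto simp: basic_array_def)
  then have "asymptotic_model_generated_by f y"
  proof (rule asymptotic_model_generated_byI[where \<eta> = "\<lambda>n. 1 / (real n + 2)"])
    show "decseq (\<lambda>n. 1 / (real n + 2))"
      by (auto simp: decseq_def intro!: divide_left_mono)
    show "(\<lambda>n. 1 / (real n + 2)) \<longlonglongrightarrow> 0"
      using LIMSEQ_ignore_initial_segment[OF lim_1_over_n, of 2] by (simp add: add.commute)
  next
    fix n g i assume g: "\<forall>j<n. \<bar>g j\<bar> \<le> (1 :: real)" and adm: "admissible n i"
    have \<delta>_mono: "\<delta> k \<le> \<delta> n" if "n \<le> k" for k
      using that unfolding \<delta>_def by (intro divide_left_mono power_mono mult_pos_pos) auto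
    \<comment> \<open>Undoing the normalization of an entry costs at most the deviation of the norm
      of its block from 1. As \<open>n \<le> j + i j\<close>, this is at most
      \<open>\<delta> n\<close>.\<close>
    have "norm ((\<Sum>j<n. g j *\<^sub>R y j (i j)) - (\<Sum>j<n. g j *\<^sub>R ?u j (M (j + i j)))) \<le> (\<Sum>j<n. \<delta> n)"
      unfolding sum_subtractf[symmetric]
    proof (rule sum_norm_le)
      fix j assume "j \<in> {..<n}"
      then have j: "j < n" "n \<le> j + i j"
        using adm by (auto simp: admissible_def trans_le_add2)
      let ?v = "?u j (M (j + i j))"
      have v: "norm ?v \<noteq> 0" using u_nonzero[of j "j + i j"] by simp
      have "g j *\<^sub>R y j (i j) - g j *\<^sub>R ?v = (g j * (inverse (norm ?v) - 1)) *\<^sub>R ?v"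
        by (simp add: y_def algebra_simps)
      then have "norm (g j *\<^sub>R y j (i j) - g j *\<^sub>R ?v) = \<bar>g j\<bar> * (\<bar>inverse (norm ?v) - 1\<bar> * \<bar>norm ?v\<bar>)"
        by (simp add: abs_mult)
      also have "\<bar>inverse (norm ?v) - 1\<bar> * \<bar>norm ?v\<bar> = \<bar>norm ?v - 1\<bar>"
        unfolding abs_mult[symmetric] using v by (simp add: left_diff_distrib abs_minus_commute)
      also have "\<bar>g j\<bar> * \<bar>norm ?v - 1\<bar> \<le> 1 * \<delta> n"
        using g j u_norm[of j "j + i j"] \<delta>_mono[OF j(2)] by (intro mult_mono) auto
      finally show "norm (g j *\<^sub>R y j (i j) - g j *\<^sub>R ?v) \<le> \<delta> n" by simp
    qed
    then have A: "\<bar>norm (\<Sum>j<n. g j *\<^sub>R y j (i j)) - norm (\<Sum>j<n. g j *\<^sub>R ?u j (M (j + i j)))\<bar> \<le> n * \<delta> n"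
      using norm_triangle_ineq3 order_trans by (fastforce)
    have coeff: "\<bar>g (block_index p l) * b l\<bar> \<le> C n" if "l < p n" for l
    proof -
      have "\<bar>g (block_index p l)\<bar> * \<bar>b l\<bar> \<le> 1 * \<bar>b l\<bar>"
        using g block_index_less[OF p that] by (intro mult_right_mono) auto
      also have "1 * \<bar>b l\<bar> \<le> C n"
        using member_le_sum[of l "{..<p (Suc n)}" "\<lambda>l. \<bar>b l\<bar>"] that p_less[of n] by (simp add: C_def)
      finally show ?thesis by (simp add: abs_mult)
    qed
    have "\<bar>norm (\<Sum>l<p n. (g (block_index p l) * b l) *\<^sub>R x l (h i l)) -
        norm (\<Sum>l<p n. (g (block_index p l) * b l) *\<^sub>R e l)\<bar> \<le> \<delta> n"
      by (rule M(1)[of n, unfolded P_def, THEN conjunct1, rule_format])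
        (use coeff h[OF adm] less_imp_le[OF p_less[of n]] in auto)
    then have B: "\<bar>norm (\<Sum>j<n. g j *\<^sub>R ?u j (M (j + i j))) - norm (\<Sum>j<n. g j *\<^sub>R f j)\<bar> \<le> \<delta> n"
      unfolding u_sum f_sum .
    have "n * \<delta> n + \<delta> n = (real n + 1) / (real n + 2)\<^sup>2"
      by (simp add: \<delta>_def add_divide_distrib)
    also have "\<dots> \<le> (real n + 2) / (real n + 2)\<^sup>2"
      by (intro divide_right_mono) auto
    also have "\<dots> = 1 / (real n + 2)"
      by (simp add: power2_eq_square)
    finally have "n * \<delta> n + \<delta> n \<le> 1 / (real n + 2)" .
    with A B show "\<bar>norm (\<Sum>j<n. g j *\<^sub>R y j (i j)) - norm (\<Sum>j<n. g j *\<^sub>R f j)\<bar> \<le> 1 / (real n + 2)"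
      by linarith
  qed auto
  then show ?thesis
    by (auto simp: asymptotic_model_of_def)
qed

subsection \<open>Basis constants of the rows\<close>

lemma weakly_null_diagonal_block:
  assumes "\<And>n. weakly_null (x n)"
  shows "weakly_null (diagonal_block x p b k)"
  unfolding weakly_null_def
proof (intro allI impI)
  fix \<phi> :: "'a \<Rightarrow> real" assume \<phi>: "bounded_linear \<phi>"
  then interpret bounded_linear \<phi> .
  have "(\<lambda>N. \<phi> (x l (N + l))) \<longlonglongrightarrow> 0" for l
    using LIMSEQ_ignore_initial_segment[of "\<lambda>i. \<phi> (x l i)" 0 l] assms \<phi>
    by (simp add: weakly_null_def)
  then have "(\<lambda>N. \<Sum>l = p k..<p (Suc k). b l * \<phi> (x l (N + l))) \<longlonglongrightarrow> (\<Sum>l = p k..<p (Suc k). b l * 0)"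
    by (intro tendsto_sum tendsto_mult_left)
  then show "(\<lambda>N. \<phi> (diagonal_block x p b k N)) \<longlonglongrightarrow> 0"
    by (simp add: diagonal_block_def sum scale)
qed

lemma diagonal_block_in_span:
  assumes "strict_mono p" "k \<le> i"
  shows "diagonal_block x p b k N \<in> span ((\<lambda>(l, s). x l s) ` ({..<p (Suc i)} \<times> {..<N + p (Suc i)}))"
  unfolding diagonal_block_def
proof (intro span_sum span_scale span_base)
  fix l assume "l \<in> {p k..<p (Suc k)}"
  moreover have "p (Suc k) \<le> p (Suc i)"
    using assms by (simp add: strict_mono_less_eq)
  ultimately show "x l (N + l) \<in> (\<lambda>(l, s). x l s) ` ({..<p (Suc i)} \<times> {..<N + p (Suc i)})"
    by (intro rev_image_eqI[of "(l, N + l)"]) auto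
qed

text \<open>For a given \<open>M\<close> the spanning set depends on \<open>k\<close> and
  \<open>n\<close> only through \<open>k + n\<close>. So one finite-dimensional subspace per stage
  in the choice of \<open>M\<close> serves all rows.\<close>

lemma row_partial_sum_in_span:
  assumes "strict_mono p" "mono M"
  shows "(\<Sum>i<Suc n. a i *\<^sub>R diagonal_block x p b k (M (k + i)))
    \<in> span ((\<lambda>(l, s). x l s) ` ({..<p (Suc (k + n))} \<times> {..<M (k + n) + p (Suc (k + n))}))"
proof (intro span_sum span_scale)
  fix i assume i: "i \<in> {..<Suc n}"
  have "M (k + i) \<le> M (k + n)" "p (Suc (k + i)) \<le> p (Suc (k + n))"
    using i assms by (auto intro: monoD simp: strict_mono_less_eq)
  then show "diagonal_block x p b k (M (k + i))
      \<in> span ((\<lambda>(l, s). x l s) ` ({..<p (Suc (k + n))} \<times> {..<M (k + n) + p (Suc (k + n))}))"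
    by (intro subsetD[OF span_mono diagonal_block_in_span[OF assms(1), of k "k + i"]] image_mono) auto
qed

text \<open>Mazur's selection is made for all rows at once: \<open>M (Suc i)\<close> lies so far out
  that the blocks up to number \<open>Suc i\<close> are almost orthogonal to everything stage
  \<open>i\<close> can have used.\<close>

lemma asymptotic_model_of_weakly_null_blocks:
  fixes x :: "nat \<Rightarrow> nat \<Rightarrow> 'a::banach" and e f :: "nat \<Rightarrow> 'b::banach"
  assumes model: "asymptotic_model_generated_by e x" and null: "\<And>n. weakly_null (x n)"
    and p: "strict_mono p" "p 0 = 0"
    and f: "\<And>k. f k = (\<Sum>l = p k..<p (Suc k). b l *\<^sub>R e l)" "\<And>k. norm (f k) = 1"
  shows "asymptotic_model_of TYPE('a) f"
proof -
  \<comment> \<open>The products of the ratios \<open>c i / c (Suc i)\<close> telescope and stay below 2.\<close>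
  define c :: "nat \<Rightarrow> real" where "c i = 1 + 1 / (real i + 1)" for i
  have c: "1 \<le> c i" "c i \<le> 2" for i
    by (auto simp: c_def field_simps)
  have c_ratio: "1 < c i / c (Suc i)" for i
  proof -
    have "c (Suc i) < c i"
      by (simp add: c_def divide_strict_left_mono add_pos_pos)
    then show ?thesis
      using c(1)[of "Suc i"] by (simp add: less_divide_eq)
  qed
  define B where "B i N0 = (\<lambda>(l, s). x l s) ` ({..<p (Suc i)} \<times> {..<N0 + p (Suc i)})" for i N0
  define Q where "Q i N0 N \<longleftrightarrow> N0 \<le> N \<and> (\<forall>k\<in>{..Suc i}. \<forall>v\<in>span (B i N0). \<forall>t.
      norm v \<le> c i / c (Suc i) * norm (v + t *\<^sub>R diagonal_block x p b k N))" for i N0 N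
  show ?thesis
  proof (rule asymptotic_model_of_blocks[OF model p, where f = f and b = b and Q = Q])
    fix i N0
    have low: "\<forall>\<^sub>F N in sequentially. 1/2 \<le> norm (diagonal_block x p b k N)" for k
      using diagonal_block_norm_eventually[OF model half_gt_zero[OF zero_less_one], of p b k]
      unfolding f(1)[symmetric] f(2) by eventually_elim linarith
    have "finite (B i N0)" by (simp add: B_def)
    then have "\<forall>k\<in>{..Suc i}. \<forall>\<^sub>F N in sequentially. \<forall>v\<in>span (B i N0). \<forall>t.
        norm v \<le> c i / c (Suc i) * norm (v + t *\<^sub>R diagonal_block x p b k N)"
      by (intro ballI weakly_null_eventually_almost_orthogonal weakly_null_diagonal_block null low c_ratio)
    then show "\<forall>\<^sub>F N in sequentially. Q i N0 N"
      unfolding Q_def by (intro eventually_conj eventually_ge_at_top eventually_ball_finite) auto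
  next
    fix M assume Q: "\<And>i. Q i (M i) (M (Suc i))"
      and nz: "\<And>k i. k \<le> i \<Longrightarrow> diagonal_block x p b k (M i) \<noteq> 0"
    have M: "mono M"
      using Q by (intro incseq_SucI) (simp add: Q_def)
    have "K_basic_seq 2 \<infinity> (\<lambda>i. diagonal_block x p b k (M (k + i)))" for k
      unfolding K_basic_seq_def
    proof (intro conjI allI impI)
      fix n m :: nat and a :: "nat \<Rightarrow> real" assume nm: "n < m \<and> enat m \<le> \<infinity>"
      define S where "S n = (\<Sum>i<n. a i *\<^sub>R diagonal_block x p b k (M (k + i)))" for n
      \<comment> \<open>Dividing by \<open>c\<close> absorbs the loss at each stage, so these
        quotients do not decrease along the row.\<close>
      have step: "norm (S (Suc r)) / c (k + r) \<le> norm (S (Suc (Suc r))) / c (k + Suc r)" for r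
      proof -
        have "S (Suc r) \<in> span (B (k + r) (M (k + r)))"
          unfolding S_def B_def by (rule row_partial_sum_in_span[OF p(1) M])
        then have "norm (S (Suc r)) \<le> c (k + r) / c (k + Suc r) * norm (S (Suc (Suc r)))"
          using Q[of "k + r"] unfolding Q_def S_def sum.lessThan_Suc[of _ "Suc r"]
          by (auto dest!: bspec[of _ _ k])
        then show ?thesis
          using c(1)[of "k + r"] c(1)[of "k + Suc r"] by (simp add: field_simps)
      qed
      have "norm (S n) \<le> 2 * norm (S m)"
      proof (cases n)
        case (Suc r)
        obtain t where t: "m = Suc t" "r \<le> t"
          using nm Suc by (cases m) auto
        have "norm (S (Suc r)) / c (k + r) \<le> norm (S (Suc t)) / c (k + t)"
          using t(2) step by (rule lift_Suc_mono_le[of "\<lambda>r. norm (S (Suc r)) / c (k + r)", rotated])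
        then have "norm (S (Suc r)) \<le> c (k + r) * (norm (S (Suc t)) / c (k + t))"
          using c(1)[of "k + r"] by (simp add: field_simps)
        also have "\<dots> \<le> 2 * norm (S (Suc t))"
          using c(1)[of "k + r"] c(2)[of "k + r"] c(1)[of "k + t"]
          by (intro mult_mono) (auto simp: field_simps mult_le_cancel_left1)
        finally show ?thesis by (simp add: Suc t)
      qed (simp add: S_def)
      then show "norm (\<Sum>i<n. a i *\<^sub>R diagonal_block x p b k (M (k + i)))
          \<le> 2 * norm (\<Sum>i<m. a i *\<^sub>R diagonal_block x p b k (M (k + i)))"
        by (simp add: S_def)
    qed (simp add: nz)
    then show "\<exists>K. \<forall>k. K_basic_seq K \<infinity> (\<lambda>i. diagonal_block x p b k (M (k + i)))"
      by blast
  qed (fact f)+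
qed

section \<open>Rows from block basic arrays\<close>

text \<open>The cutoff \<open>R'\<close> stays free so that the expansions of two vectors can be
  added over a common range.\<close>

lemma span_image_coefficients:
  fixes z :: "nat \<Rightarrow> 'a::real_vector"
  assumes "w \<in> span (z ` A)"
  obtains a R where "\<And>r. r \<notin> A \<Longrightarrow> a r = 0" "\<And>R'. R \<le> R' \<Longrightarrow> w = (\<Sum>r<R'. a r *\<^sub>R z r)"
proof -
  from assms have "\<exists>a. (\<forall>r. r \<notin> A \<longrightarrow> a r = 0) \<and> (\<exists>R. \<forall>R'\<ge>R. w = (\<Sum>r<R'. a r *\<^sub>R z r))"
  proof (induction rule: span_induct_alt)
    case base
    show ?case by (rule exI[of _ "\<lambda>_. 0"]) simp
  next
    case (step c v w)
    then obtain a R s where a: "\<forall>r. r \<notin> A \<longrightarrow> a r = 0" "\<forall>R'\<ge>R. w = (\<Sum>r<R'. a r *\<^sub>R z r)"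
      and s: "s \<in> A" "v = z s" by auto
    let ?a = "\<lambda>r. a r + (if r = s then c else 0)"
    have "c *\<^sub>R v + w = (\<Sum>r<R'. ?a r *\<^sub>R z r)" if R': "max R (Suc s) \<le> R'" for R'
    proof -
      have "(\<Sum>r<R'. (if r = s then c else 0) *\<^sub>R z r) = (\<Sum>r<R'. if r = s then c *\<^sub>R z r else 0)"
        by (intro sum.cong) auto
      also have "\<dots> = c *\<^sub>R v"
        using R' s(2) by (simp add: Suc_le_eq)
      finally show ?thesis
        using a(2) R' by (simp add: scaleR_add_left sum.distrib)
    qed
    moreover have "\<forall>r. r \<notin> A \<longrightarrow> ?a r = 0"
      using a(1) s(1) by auto
    ultimately show ?case
      by (intro exI[of _ ?a] conjI exI[of _ "max R (Suc s)"]) auto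
  qed
  with that show thesis by blast
qed

text \<open>The coefficients of \<open>v\<close> and \<open>w\<close> occupy disjoint ranges, so
  \<open>v\<close> is the partial sum at \<open>R\<close> of an expansion of
  \<open>v + w\<close>.\<close>

lemma basic_seq_projection_bound:
  assumes K: "K_basic_seq K \<infinity> z" and v: "v \<in> span (z ` {..<R})" and w: "w \<in> span (z ` {R..})"
  shows "norm v \<le> K * norm (v + w)"
proof -
  obtain a Ra where a: "\<And>r. r \<notin> {..<R} \<Longrightarrow> a r = 0" "\<And>R'. Ra \<le> R' \<Longrightarrow> v = (\<Sum>r<R'. a r *\<^sub>R z r)"
    by (rule span_image_coefficients[OF v]) blast
  obtain d Rd where d: "\<And>r. r \<notin> {R..} \<Longrightarrow> d r = 0" "\<And>R'. Rd \<le> R' \<Longrightarrow> w = (\<Sum>r<R'. d r *\<^sub>R z r)"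
    by (rule span_image_coefficients[OF w]) blast
  define T where "T = Suc (max R (max Ra Rd))"
  have T: "R < T" "Ra \<le> T" "Rd \<le> T" by (auto simp: T_def)
  have vw: "v + w = (\<Sum>r<T. (a r + d r) *\<^sub>R z r)"
    using a(2)[OF T(2)] d(2)[OF T(3)] by (simp add: scaleR_add_left sum.distrib)
  have "v = (\<Sum>r<R. a r *\<^sub>R z r)"
    unfolding a(2)[OF T(2)] using T(1) a(1) by (intro sum.mono_neutral_right) auto
  also have "\<dots> = (\<Sum>r<R. (a r + d r) *\<^sub>R z r)"
    using d(1) by (intro sum.cong) auto
  finally show ?thesis
    using K T(1) unfolding vw K_basic_seq_def by auto
qed

text \<open>Entry \<open>s\<close> of a row is a finite combination of the \<open>z l\<close> with
  \<open>s \<le> l\<close>. For fast growing \<open>M\<close> the first \<open>n\<close> entries of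
  a new row are supported before \<open>M (k + n)\<close> and the later ones from there on, so the
  rows inherit the constant of \<open>z\<close>.\<close>

lemma asymptotic_model_of_block_basic_blocks:
  fixes x :: "nat \<Rightarrow> nat \<Rightarrow> 'a::banach" and e f :: "nat \<Rightarrow> 'b::banach"
  assumes model: "asymptotic_model_generated_by e x"
    and z: "basic_seq \<infinity> z" and block: "\<And>n. block_basis \<infinity> (x n) z"
    and p: "strict_mono p" "p 0 = 0"
    and f: "\<And>k. f k = (\<Sum>l = p k..<p (Suc k). b l *\<^sub>R e l)" "\<And>k. norm (f k) = 1"
  shows "asymptotic_model_of TYPE('a) f"
proof -
  obtain K where K: "K_basic_seq K \<infinity> z"
    using z by (auto simp: basic_seq_def)
  have x_eq: "\<exists>q r. s \<le> q \<and> x n s \<in> span (z ` {q..<r})" for n s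
  proof -
    obtain q d where q: "strict_mono q" "x n s = (\<Sum>l = q s..<q (Suc s). d l *\<^sub>R z l)"
      using block[of n] by (auto simp: block_basis_def)
    have "x n s \<in> span (z ` {q s..<q (Suc s)})"
      unfolding q(2) by (intro span_sum span_scale span_base) auto
    with strict_mono_imp_increasing[OF q(1)] show ?thesis by blast
  qed
  have x_tail: "x n s \<in> span (z ` {s..})" for n s
  proof -
    obtain q r where "s \<le> q" "x n s \<in> span (z ` {q..<r})"
      using x_eq by blast
    then show ?thesis
      by (elim subsetD[OF span_mono, rotated]) auto
  qed
  have x_head: "\<forall>\<^sub>F N in sequentially. x n s \<in> span (z ` {..<N})" for n s
  proof -
    obtain q r where "x n s \<in> span (z ` {q..<r})"
      using x_eq by blast
    then have "x n s \<in> span (z ` {..<N})" if "r \<le> N" for N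
      by (rule subsetD[OF span_mono, rotated]) (use that in auto)
    then show ?thesis by (auto simp: eventually_sequentially)
  qed
  define B where "B i N0 = (\<lambda>(l, s). x l s) ` ({..<p (Suc i)} \<times> {..<N0 + p (Suc i)})" for i N0
  \<comment> \<open>The new \<open>N\<close> lies beyond the supports of all entries of
    \<open>x\<close> that stage \<open>i\<close> with shift \<open>N0\<close> can use.\<close>
  define Q where "Q i N0 N \<longleftrightarrow> N0 \<le> N \<and> (\<forall>v\<in>B i N0. v \<in> span (z ` {..<N}))" for i N0 N
  show ?thesis
  proof (rule asymptotic_model_of_blocks[OF model p, where f = f and b = b and Q = Q])
    fix i N0
    show "\<forall>\<^sub>F N in sequentially. Q i N0 N"
      unfolding Q_def
      by (intro eventually_conj eventually_ge_at_top eventually_ball_finite) (auto simp: B_def x_head)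
  next
    fix M assume Q: "\<And>i. Q i (M i) (M (Suc i))"
      and nz: "\<And>k i. k \<le> i \<Longrightarrow> diagonal_block x p b k (M i) \<noteq> 0"
    have M: "mono M"
      using Q by (intro incseq_SucI) (simp add: Q_def)
    have "K_basic_seq K \<infinity> (\<lambda>i. diagonal_block x p b k (M (k + i)))" for k
      unfolding K_basic_seq_def
    proof (intro conjI allI impI)
      fix n m :: nat and a :: "nat \<Rightarrow> real" assume nm: "n < m \<and> enat m \<le> \<infinity>"
      let ?u = "\<lambda>i. a i *\<^sub>R diagonal_block x p b k (M (k + i))"
      have "sum ?u {..<n} \<in> span (z ` {..<M (k + n)})"
      proof (cases n)
        case (Suc r)
        have "sum ?u {..<n} \<in> span (B (k + r) (M (k + r)))"
          unfolding Suc B_def by (rule row_partial_sum_in_span[OF p(1) M])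
        moreover have "span (B (k + r) (M (k + r))) \<subseteq> span (z ` {..<M (k + n)})"
          using Q[of "k + r"] Suc by (intro span_minimal subspace_span) (auto simp: Q_def)
        ultimately show ?thesis by blast
      qed (simp add: span_zero)
      moreover have "sum ?u {n..<m} \<in> span (z ` {M (k + n)..})"
      proof (intro span_sum span_scale)
        fix i assume "i \<in> {n..<m}"
        then have "M (k + n) \<le> M (k + i)"
          by (intro monoD[OF M]) simp
        then show "diagonal_block x p b k (M (k + i)) \<in> span (z ` {M (k + n)..})"
          unfolding diagonal_block_def
          by (intro span_sum span_scale subsetD[OF span_mono x_tail]) auto
      qed
      ultimately have "norm (sum ?u {..<n}) \<le> K * norm (sum ?u {..<n} + sum ?u {n..<m})"
        by (rule basic_seq_projection_bound[OF K])
      also have "sum ?u {..<n} + sum ?u {n..<m} = sum ?u {..<m}"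
        using nm sum.atLeastLessThan_concat[of 0 n m ?u] by (simp add: lessThan_atLeast0)
      finally show "norm (sum ?u {..<n}) \<le> K * norm (sum ?u {..<m})" .
    qed (simp add: nz)
    then show "\<exists>K. \<forall>k. K_basic_seq K \<infinity> (\<lambda>i. diagonal_block x p b k (M (k + i)))"
      by blast
  qed (fact f)+
qed

theorem proposition3p5:
  fixes x :: "nat \<Rightarrow> nat \<Rightarrow> 'a::banach" and e f :: "nat \<Rightarrow> 'b::banach"
  assumes "separable_space (euclidean :: 'a topology)"
    and "infinite_dimensional TYPE('a)"
    and "asymptotic_model_generated_by e x"
    and "weakly_null_basic_array x \<or> (\<exists>z. basic_seq \<infinity> z \<and> block_basic_array x z)"
    and "block_basis \<infinity> f e" and "\<forall>i. norm (f i) = 1"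
  shows "asymptotic_model_of TYPE('a) f"
proof -
  obtain p b where p: "strict_mono p" and f: "\<And>k. f k = (\<Sum>l = p k..<p (Suc k). b l *\<^sub>R e l)"
    using assms(5) by (auto simp: block_basis_def)
  \<comment> \<open>A block basis may start at \<open>p 0 > 0\<close>. The first block is extended
    down to 0 with zero coefficients, which leaves \<open>f\<close> unchanged.\<close>
  define p' where "p' = p(0 := 0)"
  define b' where "b' l = (if l < p 0 then 0 else b l)" for l
  have p': "strict_mono p'" "p' 0 = 0"
    using p unfolding p'_def strict_mono_Suc_iff by (auto split: nat.split intro: le_less_trans)
  have f': "f k = (\<Sum>l = p' k..<p' (Suc k). b' l *\<^sub>R e l)" for k
  proof -
    have "p 0 \<le> p k"
      using p by (simp add: strict_mono_less_eq)
    then show ?thesis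
      unfolding f p'_def b'_def by (intro sum.mono_neutral_cong_left) auto
  qed
  from assms(4) show ?thesis
  proof
    assume "weakly_null_basic_array x"
    then show ?thesis
      using assms(6) by (intro asymptotic_model_of_weakly_null_blocks[OF assms(3) _ p', where f = f and b = b'])
        (simp_all add: weakly_null_basic_array_def f'[symmetric])
  next
    assume "\<exists>z. basic_seq \<infinity> z \<and> block_basic_array x z"
    then obtain z where "basic_seq \<infinity> z" "\<And>n. block_basis \<infinity> (x n) z"
      by (auto simp: block_basic_array_def)
    then show ?thesis
      using assms(6)
      by (intro asymptotic_model_of_block_basic_blocks[OF assms(3) _ _ p', where f = f and b = b'])
        (simp_all add: f'[symmetric])
  qed
qed

end
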